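(* Let $X$ be a set, $\mathcal{C}$ a simplicial complex on $X$, $\mathcal{L}$ a language of regular logic whose variables include $X$, and $\vdash$ a regular theory in $\mathcal{L}$. Let $[\![-]\!]$ be an interpretation of $\mathcal{L}$ in a regular category $\mathbf{S}$ that models $\vdash$. Then the inchworm fragment $\vdash_{\mathcal{C}}$ of $\vdash$ is sound with respect to no-signalling models in $[\![-]\!]$: for every $\Gamma\subseteq\Phi_{\mathcal{C}}$ and $\varphi\in\Phi_{\mathcal{C}}$, if $\Gamma\vdash_{\mathcal{C}}\varphi$, then $A\vDash\varphi$ for every no-signalling model $A$ of $\Gamma$ in $[\![-]\!]$.
   Context: A simplicial complex on a set $X$ is a family $\mathcal{C}$ of finite subsets of $X$ closed under taking subsets and with $\bigcup\mathcal{C}=X$. $\mathcal{L}$ is a language of (at least) regular first-order logic (with $\top$, $\wedge$, $\exists$) whose variables include $X$; each $x\in X$ has a type $T_x$. For $U\subseteq X$, $\Phi_U$ is the set of formulas in the context $U$ (free variables among $U$, with $x:T_x$), and $\Phi_{\mathcal{C}}=\bigcup_{U\in\mathcal{C}}\Phi_U$. For $\Gamma\subseteq\Phi_{\mathcal{C}}$ write $\Gamma_U=\Gamma\cap\Phi_U$. The theory $\vdash$ is an entailment relation $\Gamma\vdash\varphi$ between (possibly infinite) sets of formulas and formulas. The inchworm fragment $\vdash_{\mathcal{C}}$ is the relation between subsets of $\Phi_{\mathcal{C}}$ and elements of $\Phi_{\mathcal{C}}$ defined inductively by: (i) $\Gamma\vdash_{\mathcal{C}}\varphi$ if there is $U\in\mathcal{C}$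 with $\varphi\in\Phi_U$ and $\Gamma_U\vdash\varphi$; (ii) if $\Gamma\vdash_{\mathcal{C}}\varphi$ and $\Delta\cup\{\varphi\}\vdash_{\mathcal{C}}\psi$ then $\Gamma\cup\Delta\vdash_{\mathcal{C}}\psi$. Given an interpretation $[\![-]\!]$ of $\mathcal{L}$ in a regular category $\mathbf{S}$, put $F_U=\prod_{x\in U}[\![T_x]\!]$ for $U\subseteq X$, with projections $F_{U\subseteq V}:F_V\to F_U$ for $U\subseteq V$; for $\varphi\in\Phi_U$, $[\![\varphi]\!]_U\rightarrowtail F_U$ is the subobject interpreting $\varphi$ in context $U$. $[\![-]\!]$ models $\vdash$ if whenever $\Gamma\vdash\varphi$ there is a finite $\Delta\subseteq\Gamma$ with $\bigwedge_{\psi\in\Delta}[\![\psi]\!]_U\leqslant[\![\varphi]\!]_U$ (for $U$ a context containing the free variables of $\Delta$ and $\varphi$). A subpresheaf $A$ of $F$ is a family of subobjects $A_U\rightarrowtail F_U$ ($U\in\mathcal{C}$) such that for $U\subseteq V\in\mathcal{C}$, $F_{U\subseteq V}$ restricts to an arrow $A_{U\subseteq V}:A_V\to A_U$; it is no-signalling if every $A_{U\subseteq V}$ is a regular epimorphism. For $\varphi\in\Phi_{\mathcal{C}}$, $A\vDash\varphi$ means $A_U\leqslant[\![\varphi]\!]_U$ for every $U\in\mathcal{C}$ with $\varphi\in\Phi_U$. A no-signalling model of $\Gamma$ is a no-signalling subpresheaf $A$ of $F$ with $A\vDash\psi$ for all $\psi\in\Gamma$. *)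

theory Defs
  imports Main
begin

section \<open>Regular categories\<close>

record ('o, 'a) category_struct =
  Obj :: "'o set"
  Arr :: "'a set"
  Dom :: "'a \<Rightarrow> 'o"
  Cod :: "'a \<Rightarrow> 'o"
  Id :: "'o \<Rightarrow> 'a"
  Comp :: "'a \<Rightarrow> 'a \<Rightarrow> 'a"  (infixl "\<cdot>\<index>" 70)

definition hom :: "('o, 'a, 'm) category_struct_scheme \<Rightarrow> 'o \<Rightarrow> 'o \<Rightarrow> 'a set" where
  "hom S A B = {f \<in> Arr S. Dom S f = A \<and> Cod S f = B}"

locale category =
  fixes S :: "('o, 'a, 'm) category_struct_scheme" (structure)
  assumes Dom_in_Obj: "f \<in> Arr S \<Longrightarrow> Dom S f \<in> Obj S"
    and Cod_in_Obj: "f \<in> Arr S \<Longrightarrow> Cod S f \<in> Obj S"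
    and Id_in_hom: "A \<in> Obj S \<Longrightarrow> Id S A \<in> hom S A A"
    and Comp_in_hom: "f \<in> hom S A B \<Longrightarrow> g \<in> hom S B C \<Longrightarrow> g \<cdot> f \<in> hom S A C"
    and Comp_Id: "f \<in> hom S A B \<Longrightarrow> f \<cdot> Id S A = f"
    and Id_Comp: "f \<in> hom S A B \<Longrightarrow> Id S B \<cdot> f = f"
    and Comp_assoc: "f \<in> hom S A B \<Longrightarrow> g \<in> hom S B C \<Longrightarrow> h \<in> hom S C D \<Longrightarrow>
      (h \<cdot> g) \<cdot> f = h \<cdot> (g \<cdot> f)"

text \<open>
  A diagram is given by a set \<open>J\<close> of vertices, an object \<open>D j\<close> for each vertex and a set \<open>E\<close>
  of labelled edges, where \<open>(i, a, j)\<close> stands for an arrow \<open>a : D i \<rightarrow> D j\<close> from vertex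
  \<open>i\<close> to vertex \<open>j\<close>.  A functor from a small category is the special case where the
  edges are the images of all its arrows.
\<close>

definition is_diagram ::
  "('o, 'a, 'm) category_struct_scheme \<Rightarrow> 'j set \<Rightarrow> ('j \<Rightarrow> 'o) \<Rightarrow> ('j \<times> 'a \<times> 'j) set \<Rightarrow> bool" where
  "is_diagram S J D E \<longleftrightarrow>
     (\<forall>j\<in>J. D j \<in> Obj S) \<and> (\<forall>(i, a, j)\<in>E. i \<in> J \<and> j \<in> J \<and> a \<in> hom S (D i) (D j))"

definition is_cone ::
  "('o, 'a, 'm) category_struct_scheme \<Rightarrow> 'j set \<Rightarrow> ('j \<Rightarrow> 'o) \<Rightarrow> ('j \<times> 'a \<times> 'j) set \<Rightarrow>
   'o \<Rightarrow> ('j \<Rightarrow> 'a) \<Rightarrow> bool" where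
  "is_cone S J D E K q \<longleftrightarrow>
     K \<in> Obj S \<and> (\<forall>j\<in>J. q j \<in> hom S K (D j)) \<and> (\<forall>(i, a, j)\<in>E. a \<cdot>\<^bsub>S\<^esub> q i = q j)"

definition is_limit ::
  "('o, 'a, 'm) category_struct_scheme \<Rightarrow> 'j set \<Rightarrow> ('j \<Rightarrow> 'o) \<Rightarrow> ('j \<times> 'a \<times> 'j) set \<Rightarrow>
   'o \<Rightarrow> ('j \<Rightarrow> 'a) \<Rightarrow> bool" where
  "is_limit S J D E P p \<longleftrightarrow>
     is_cone S J D E P p \<and>
     (\<forall>K q. is_cone S J D E K q \<longrightarrow>
        (\<exists>!h. h \<in> hom S K P \<and> (\<forall>j\<in>J. p j \<cdot>\<^bsub>S\<^esub> h = q j)))"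

text \<open>Vertices are taken in \<open>nat\<close>; this loses nothing, as every finite set can be re-indexed.\<close>

definition has_finite_limits :: "('o, 'a, 'm) category_struct_scheme \<Rightarrow> bool" where
  "has_finite_limits S \<longleftrightarrow>
     (\<forall>(J :: nat set) D E. finite J \<and> finite E \<and> is_diagram S J D E \<longrightarrow>
        (\<exists>P p. is_limit S J D E P p))"

definition is_product ::
  "('o, 'a, 'm) category_struct_scheme \<Rightarrow> 'i set \<Rightarrow> ('i \<Rightarrow> 'o) \<Rightarrow> 'o \<Rightarrow> ('i \<Rightarrow> 'a) \<Rightarrow> bool" where
  "is_product S I D P p \<longleftrightarrow> is_limit S I D {} P p"

definition is_pullback ::
  "('o, 'a, 'm) category_struct_scheme \<Rightarrow> 'a \<Rightarrow> 'a \<Rightarrow> 'a \<Rightarrow> 'a \<Rightarrow> bool" where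
  "is_pullback S f g p q \<longleftrightarrow>
     (\<exists>A B C P. f \<in> hom S A C \<and> g \<in> hom S B C \<and> p \<in> hom S P A \<and> q \<in> hom S P B \<and>
        f \<cdot>\<^bsub>S\<^esub> p = g \<cdot>\<^bsub>S\<^esub> q \<and>
        (\<forall>K. \<forall>u \<in> hom S K A. \<forall>v \<in> hom S K B. f \<cdot>\<^bsub>S\<^esub> u = g \<cdot>\<^bsub>S\<^esub> v \<longrightarrow>
           (\<exists>!h. h \<in> hom S K P \<and> p \<cdot>\<^bsub>S\<^esub> h = u \<and> q \<cdot>\<^bsub>S\<^esub> h = v)))"

definition is_equalizer ::
  "('o, 'a, 'm) category_struct_scheme \<Rightarrow> 'a \<Rightarrow> 'a \<Rightarrow> 'a \<Rightarrow> bool" where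
  "is_equalizer S f g e \<longleftrightarrow>
     (\<exists>A B P. f \<in> hom S A B \<and> g \<in> hom S A B \<and> e \<in> hom S P A \<and> f \<cdot>\<^bsub>S\<^esub> e = g \<cdot>\<^bsub>S\<^esub> e \<and>
        (\<forall>K. \<forall>u \<in> hom S K A. f \<cdot>\<^bsub>S\<^esub> u = g \<cdot>\<^bsub>S\<^esub> u \<longrightarrow>
           (\<exists>!h. h \<in> hom S K P \<and> e \<cdot>\<^bsub>S\<^esub> h = u)))"

definition is_coequalizer ::
  "('o, 'a, 'm) category_struct_scheme \<Rightarrow> 'a \<Rightarrow> 'a \<Rightarrow> 'a \<Rightarrow> bool" where
  "is_coequalizer S f g e \<longleftrightarrow>
     (\<exists>A B Q. f \<in> hom S A B \<and> g \<in> hom S A B \<and> e \<in> hom S B Q \<and> e \<cdot>\<^bsub>S\<^esub> f = e \<cdot>\<^bsub>S\<^esub> g \<and>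
        (\<forall>K. \<forall>u \<in> hom S B K. u \<cdot>\<^bsub>S\<^esub> f = u \<cdot>\<^bsub>S\<^esub> g \<longrightarrow>
           (\<exists>!h. h \<in> hom S Q K \<and> h \<cdot>\<^bsub>S\<^esub> e = u)))"

definition regular_epi :: "('o, 'a, 'm) category_struct_scheme \<Rightarrow> 'a \<Rightarrow> bool" where
  "regular_epi S e \<longleftrightarrow> (\<exists>f g. is_coequalizer S f g e)"

definition mono_arrow :: "('o, 'a, 'm) category_struct_scheme \<Rightarrow> 'a \<Rightarrow> bool" where
  "mono_arrow S m \<longleftrightarrow> m \<in> Arr S \<and>
     (\<forall>K. \<forall>u \<in> hom S K (Dom S m). \<forall>v \<in> hom S K (Dom S m). m \<cdot>\<^bsub>S\<^esub> u = m \<cdot>\<^bsub>S\<^esub> v \<longrightarrow> u = v)"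

locale regular_category = category +
  assumes finite_limits: "has_finite_limits S"
    and kernel_pair_coequalizer: "is_pullback S f f p q \<Longrightarrow> \<exists>e. is_coequalizer S p q e"
    and regular_epi_stable: "is_pullback S f e p q \<Longrightarrow> regular_epi S e \<Longrightarrow> regular_epi S p"


section \<open>Subobjects and chosen limits\<close>

text \<open>
  A subobject is represented by a mono; two monos represent the same subobject iff each is
  \<open>sub_le\<close> the other.  The operations below pick representatives by Hilbert choice, and
  everything stated in terms of them is invariant under isomorphism.
\<close>

definition Sub :: "('o, 'a, 'm) category_struct_scheme \<Rightarrow> 'o \<Rightarrow> 'a set" where
  "Sub S A = {m. mono_arrow S m \<and> Cod S m = A}"

definition sub_le :: "('o, 'a, 'm) category_struct_scheme \<Rightarrow> 'a \<Rightarrow> 'a \<Rightarrow> bool" where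
  "sub_le S m n \<longleftrightarrow> (\<exists>h \<in> hom S (Dom S m) (Dom S n). n \<cdot>\<^bsub>S\<^esub> h = m)"

definition sub_meet :: "('o, 'a, 'm) category_struct_scheme \<Rightarrow> 'o \<Rightarrow> 'a set \<Rightarrow> 'a" where
  "sub_meet S A M = (SOME m. m \<in> Sub S A \<and> (\<forall>n\<in>M. sub_le S m n) \<and>
     (\<forall>k \<in> Sub S A. (\<forall>n\<in>M. sub_le S k n) \<longrightarrow> sub_le S k m))"

definition sub_pullback :: "('o, 'a, 'm) category_struct_scheme \<Rightarrow> 'a \<Rightarrow> 'a \<Rightarrow> 'a" where
  "sub_pullback S f m = (SOME p. \<exists>q. is_pullback S f m p q)"

definition sub_image :: "('o, 'a, 'm) category_struct_scheme \<Rightarrow> 'a \<Rightarrow> 'a" where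
  "sub_image S f = (SOME m. mono_arrow S m \<and>
     (\<exists>e. regular_epi S e \<and> Cod S e = Dom S m \<and> m \<cdot>\<^bsub>S\<^esub> e = f))"

definition sub_equalizer :: "('o, 'a, 'm) category_struct_scheme \<Rightarrow> 'a \<Rightarrow> 'a \<Rightarrow> 'a" where
  "sub_equalizer S f g = (SOME e. is_equalizer S f g e)"

definition prod_cone ::
  "('o, 'a, 'm) category_struct_scheme \<Rightarrow> 'i set \<Rightarrow> ('i \<Rightarrow> 'o) \<Rightarrow> 'o \<times> ('i \<Rightarrow> 'a)" where
  "prod_cone S I D = (SOME Pp. is_product S I D (fst Pp) (snd Pp))"

definition prod_ob :: "('o, 'a, 'm) category_struct_scheme \<Rightarrow> 'i set \<Rightarrow> ('i \<Rightarrow> 'o) \<Rightarrow> 'o" where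
  "prod_ob S I D = fst (prod_cone S I D)"

definition prod_pr ::
  "('o, 'a, 'm) category_struct_scheme \<Rightarrow> 'i set \<Rightarrow> ('i \<Rightarrow> 'o) \<Rightarrow> 'i \<Rightarrow> 'a" where
  "prod_pr S I D = snd (prod_cone S I D)"

definition tuple ::
  "('o, 'a, 'm) category_struct_scheme \<Rightarrow> 'i set \<Rightarrow> ('i \<Rightarrow> 'o) \<Rightarrow> 'o \<Rightarrow> ('i \<Rightarrow> 'a) \<Rightarrow> 'a" where
  "tuple S I D K q = (THE h. h \<in> hom S K (prod_ob S I D) \<and>
     (\<forall>i\<in>I. prod_pr S I D i \<cdot>\<^bsub>S\<^esub> h = q i))"


section \<open>Languages of many-sorted regular logic\<close>

datatype ('f, 'v) tm = Var 'v | Fn 'f "('f, 'v) tm list"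

datatype ('f, 'r, 'v) form =
    Top
  | Eq "('f, 'v) tm" "('f, 'v) tm"
  | Rel 'r "('f, 'v) tm list"
  | Conj "('f, 'r, 'v) form" "('f, 'r, 'v) form"
  | Ex 'v "('f, 'r, 'v) form"

text \<open>
  The symbols and variables of a language are sets rather than whole types, so that any of
  them may be empty.  The type of a variable \<open>x\<close> is \<open>vsort L x\<close>.
\<close>

record ('s, 'f, 'r, 'v) language =
  Funs :: "'f set"
  Rels :: "'r set"
  Vars :: "'v set"
  fdom :: "'f \<Rightarrow> 's list"
  fcod :: "'f \<Rightarrow> 's"
  rdom :: "'r \<Rightarrow> 's list"
  vsort :: "'v \<Rightarrow> 's"

primrec tm_sort :: "('s, 'f, 'r, 'v) language \<Rightarrow> ('f, 'v) tm \<Rightarrow> 's" where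
  "tm_sort L (Var x) = vsort L x"
| "tm_sort L (Fn f ts) = fcod L f"

primrec tm_wf :: "('s, 'f, 'r, 'v) language \<Rightarrow> ('f, 'v) tm \<Rightarrow> bool" where
  "tm_wf L (Var x) \<longleftrightarrow> x \<in> Vars L"
| "tm_wf L (Fn f ts) \<longleftrightarrow>
     f \<in> Funs L \<and> map (tm_sort L) ts = fdom L f \<and> list_all (tm_wf L) ts"

primrec tm_fv :: "('f, 'v) tm \<Rightarrow> 'v set" where
  "tm_fv (Var x) = {x}"
| "tm_fv (Fn f ts) = \<Union> (set (map tm_fv ts))"

primrec form_wf :: "('s, 'f, 'r, 'v) language \<Rightarrow> ('f, 'r, 'v) form \<Rightarrow> bool" where
  "form_wf L Top \<longleftrightarrow> True"
| "form_wf L (Eq t u) \<longleftrightarrow> tm_wf L t \<and> tm_wf L u \<and> tm_sort L t = tm_sort L u"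
| "form_wf L (Rel R ts) \<longleftrightarrow>
     R \<in> Rels L \<and> map (tm_sort L) ts = rdom L R \<and> list_all (tm_wf L) ts"
| "form_wf L (Conj \<phi> \<psi>) \<longleftrightarrow> form_wf L \<phi> \<and> form_wf L \<psi>"
| "form_wf L (Ex x \<phi>) \<longleftrightarrow> x \<in> Vars L \<and> form_wf L \<phi>"

primrec fv :: "('f, 'r, 'v) form \<Rightarrow> 'v set" where
  "fv Top = {}"
| "fv (Eq t u) = tm_fv t \<union> tm_fv u"
| "fv (Rel R ts) = \<Union> (set (map tm_fv ts))"
| "fv (Conj \<phi> \<psi>) = fv \<phi> \<union> fv \<psi>"
| "fv (Ex x \<phi>) = fv \<phi> - {x}"

definition Forms :: "('s, 'f, 'r, 'v) language \<Rightarrow> 'v set \<Rightarrow> ('f, 'r, 'v) form set" where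
  "Forms L U = {\<phi>. form_wf L \<phi> \<and> fv \<phi> \<subseteq> U}"

definition Forms_complex ::
  "('s, 'f, 'r, 'v) language \<Rightarrow> 'v set set \<Rightarrow> ('f, 'r, 'v) form set" where
  "Forms_complex L \<C> = (\<Union>U\<in>\<C>. Forms L U)"

text \<open>
  A regular theory is a collection of sequents between regular formulas (with arbitrary sets on
  the left).  No closure under deduction rules is imposed, so deductively closed entailment
  relations are a special case.
\<close>

definition regular_theory ::
  "('s, 'f, 'r, 'v) language \<Rightarrow>
   (('f, 'r, 'v) form set \<Rightarrow> ('f, 'r, 'v) form \<Rightarrow> bool) \<Rightarrow> bool" where
  "regular_theory L ent \<longleftrightarrow>
     (\<forall>\<Gamma> \<phi>. ent \<Gamma> \<phi> \<longrightarrow> \<Gamma> \<subseteq> Forms L (Vars L) \<and> \<phi> \<in> Forms L (Vars L))"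


section \<open>Interpretations in a regular category\<close>

record ('s, 'f, 'r, 'o, 'a) interp =
  sort_int :: "'s \<Rightarrow> 'o"
  fun_int :: "'f \<Rightarrow> 'a"
  rel_int :: "'r \<Rightarrow> 'a"

definition arity_ob ::
  "('o, 'a, 'm) category_struct_scheme \<Rightarrow> ('s, 'f, 'r, 'o, 'a) interp \<Rightarrow> 's list \<Rightarrow> 'o" where
  "arity_ob S I ss = prod_ob S {..<length ss} (\<lambda>i. sort_int I (ss ! i))"

definition is_interpretation ::
  "('o, 'a, 'm) category_struct_scheme \<Rightarrow> ('s, 'f, 'r, 'v) language \<Rightarrow>
   ('s, 'f, 'r, 'o, 'a) interp \<Rightarrow> bool" where
  "is_interpretation S L I \<longleftrightarrow>
     (\<forall>s. sort_int I s \<in> Obj S) \<and>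
     (\<forall>f \<in> Funs L. fun_int I f \<in> hom S (arity_ob S I (fdom L f)) (sort_int I (fcod L f))) \<and>
     (\<forall>R \<in> Rels L. rel_int I R \<in> Sub S (arity_ob S I (rdom L R)))"

definition ctx_ob ::
  "('o, 'a, 'm) category_struct_scheme \<Rightarrow> ('s, 'f, 'r, 'v) language \<Rightarrow>
   ('s, 'f, 'r, 'o, 'a) interp \<Rightarrow> 'v set \<Rightarrow> 'o" where
  "ctx_ob S L I U = prod_ob S U (\<lambda>x. sort_int I (vsort L x))"

definition ctx_pr ::
  "('o, 'a, 'm) category_struct_scheme \<Rightarrow> ('s, 'f, 'r, 'v) language \<Rightarrow>
   ('s, 'f, 'r, 'o, 'a) interp \<Rightarrow> 'v set \<Rightarrow> 'v \<Rightarrow> 'a" where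
  "ctx_pr S L I U = prod_pr S U (\<lambda>x. sort_int I (vsort L x))"

text \<open>\<open>ctx_restr S L I U V\<close> is the projection from \<open>ctx_ob S L I V\<close> to \<open>ctx_ob S L I U\<close> for \<open>U \<subseteq> V\<close>.\<close>

definition ctx_restr ::
  "('o, 'a, 'm) category_struct_scheme \<Rightarrow> ('s, 'f, 'r, 'v) language \<Rightarrow>
   ('s, 'f, 'r, 'o, 'a) interp \<Rightarrow> 'v set \<Rightarrow> 'v set \<Rightarrow> 'a" where
  "ctx_restr S L I U V =
     tuple S U (\<lambda>x. sort_int I (vsort L x)) (ctx_ob S L I V) (ctx_pr S L I V)"

definition args_tuple ::
  "('o, 'a, 'm) category_struct_scheme \<Rightarrow> ('s, 'f, 'r, 'v) language \<Rightarrow>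
   ('s, 'f, 'r, 'o, 'a) interp \<Rightarrow> 'v set \<Rightarrow> 's list \<Rightarrow> 'a list \<Rightarrow> 'a" where
  "args_tuple S L I U ss as =
     tuple S {..<length ss} (\<lambda>i. sort_int I (ss ! i)) (ctx_ob S L I U) (\<lambda>i. as ! i)"

primrec tm_int ::
  "('o, 'a, 'm) category_struct_scheme \<Rightarrow> ('s, 'f, 'r, 'v) language \<Rightarrow>
   ('s, 'f, 'r, 'o, 'a) interp \<Rightarrow> 'v set \<Rightarrow> ('f, 'v) tm \<Rightarrow> 'a" where
  "tm_int S L I U (Var x) = ctx_pr S L I U x"
| "tm_int S L I U (Fn f ts) =
     fun_int I f \<cdot>\<^bsub>S\<^esub> args_tuple S L I U (fdom L f) (map (tm_int S L I U) ts)"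

text \<open>
  \<open>form_int S L I \<phi> U\<close> is the subobject of \<open>ctx_ob S L I U\<close> interpreting \<open>\<phi>\<close> in context \<open>U\<close>.
  In the clause for \<open>Ex x \<phi>\<close> the context \<open>U\<close> may already contain a variable named \<open>x\<close>, which the
  quantifier shadows: the image is taken along the projection that forgets the bound \<open>x\<close>, in the
  context \<open>U - {x}\<close>, and is then weakened to \<open>U\<close>.  If \<open>x \<notin> U\<close>, the latter is a pullback along
  an identity.
\<close>

primrec form_int ::
  "('o, 'a, 'm) category_struct_scheme \<Rightarrow> ('s, 'f, 'r, 'v) language \<Rightarrow>
   ('s, 'f, 'r, 'o, 'a) interp \<Rightarrow> ('f, 'r, 'v) form \<Rightarrow> 'v set \<Rightarrow> 'a" where
  "form_int S L I Top U = Id S (ctx_ob S L I U)"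
| "form_int S L I (Eq t u) U = sub_equalizer S (tm_int S L I U t) (tm_int S L I U u)"
| "form_int S L I (Rel R ts) U =
     sub_pullback S (args_tuple S L I U (rdom L R) (map (tm_int S L I U) ts)) (rel_int I R)"
| "form_int S L I (Conj \<phi> \<psi>) U =
     sub_meet S (ctx_ob S L I U) {form_int S L I \<phi> U, form_int S L I \<psi> U}"
| "form_int S L I (Ex x \<phi>) U =
     sub_pullback S (ctx_restr S L I (U - {x}) U)
       (sub_image S (ctx_restr S L I (U - {x}) (insert x U) \<cdot>\<^bsub>S\<^esub> form_int S L I \<phi> (insert x U)))"

definition models_theory ::
  "('o, 'a, 'm) category_struct_scheme \<Rightarrow> ('s, 'f, 'r, 'v) language \<Rightarrow>
   ('s, 'f, 'r, 'o, 'a) interp \<Rightarrow>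
   (('f, 'r, 'v) form set \<Rightarrow> ('f, 'r, 'v) form \<Rightarrow> bool) \<Rightarrow> bool" where
  "models_theory S L I ent \<longleftrightarrow>
     (\<forall>\<Gamma> \<phi>. ent \<Gamma> \<phi> \<longrightarrow>
        (\<exists>\<Delta>. finite \<Delta> \<and> \<Delta> \<subseteq> \<Gamma> \<and>
           (\<forall>U. finite U \<and> U \<subseteq> Vars L \<and> (\<Union>\<psi>\<in>\<Delta>. fv \<psi>) \<union> fv \<phi> \<subseteq> U \<longrightarrow>
              sub_le S (sub_meet S (ctx_ob S L I U) ((\<lambda>\<psi>. form_int S L I \<psi> U) ` \<Delta>))
                (form_int S L I \<phi> U))))"


section \<open>The inchworm fragment and no-signalling models\<close>

definition simplicial_complex :: "'v set \<Rightarrow> 'v set set \<Rightarrow> bool" where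
  "simplicial_complex X \<C> \<longleftrightarrow>
     (\<forall>U\<in>\<C>. finite U) \<and> (\<forall>V\<in>\<C>. \<forall>U. U \<subseteq> V \<longrightarrow> U \<in> \<C>) \<and> \<Union>\<C> = X"

inductive inchworm ::
  "('s, 'f, 'r, 'v) language \<Rightarrow> 'v set set \<Rightarrow>
   (('f, 'r, 'v) form set \<Rightarrow> ('f, 'r, 'v) form \<Rightarrow> bool) \<Rightarrow>
   ('f, 'r, 'v) form set \<Rightarrow> ('f, 'r, 'v) form \<Rightarrow> bool"
  for L \<C> ent where
  within: "\<Gamma> \<subseteq> Forms_complex L \<C> \<Longrightarrow> U \<in> \<C> \<Longrightarrow> \<phi> \<in> Forms L U \<Longrightarrow> ent (\<Gamma> \<inter> Forms L U) \<phi> \<Longrightarrow>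
    inchworm L \<C> ent \<Gamma> \<phi>"
| cut: "inchworm L \<C> ent \<Gamma> \<phi> \<Longrightarrow> inchworm L \<C> ent (\<Delta> \<union> {\<phi>}) \<psi> \<Longrightarrow>
    inchworm L \<C> ent (\<Gamma> \<union> \<Delta>) \<psi>"

text \<open>\<open>restricts_to S f m n r\<close>: the arrow \<open>f\<close> between the ambient objects of the subobjects
  \<open>m\<close> and \<open>n\<close> restricts to the arrow \<open>r\<close> from \<open>m\<close> to \<open>n\<close>.\<close>

definition restricts_to ::
  "('o, 'a, 'm) category_struct_scheme \<Rightarrow> 'a \<Rightarrow> 'a \<Rightarrow> 'a \<Rightarrow> 'a \<Rightarrow> bool" where
  "restricts_to S f m n r \<longleftrightarrow> r \<in> hom S (Dom S m) (Dom S n) \<and> n \<cdot>\<^bsub>S\<^esub> r = f \<cdot>\<^bsub>S\<^esub> m"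

definition subpresheaf ::
  "('o, 'a, 'm) category_struct_scheme \<Rightarrow> ('s, 'f, 'r, 'v) language \<Rightarrow>
   ('s, 'f, 'r, 'o, 'a) interp \<Rightarrow> 'v set set \<Rightarrow> ('v set \<Rightarrow> 'a) \<Rightarrow> bool" where
  "subpresheaf S L I \<C> A \<longleftrightarrow>
     (\<forall>U\<in>\<C>. A U \<in> Sub S (ctx_ob S L I U)) \<and>
     (\<forall>V\<in>\<C>. \<forall>U. U \<subseteq> V \<longrightarrow> (\<exists>r. restricts_to S (ctx_restr S L I U V) (A V) (A U) r))"

definition no_signalling ::
  "('o, 'a, 'm) category_struct_scheme \<Rightarrow> ('s, 'f, 'r, 'v) language \<Rightarrow>
   ('s, 'f, 'r, 'o, 'a) interp \<Rightarrow> 'v set set \<Rightarrow> ('v set \<Rightarrow> 'a) \<Rightarrow> bool" where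
  "no_signalling S L I \<C> A \<longleftrightarrow>
     (\<forall>V\<in>\<C>. \<forall>U r. U \<subseteq> V \<longrightarrow> restricts_to S (ctx_restr S L I U V) (A V) (A U) r \<longrightarrow>
        regular_epi S r)"

definition satisfies ::
  "('o, 'a, 'm) category_struct_scheme \<Rightarrow> ('s, 'f, 'r, 'v) language \<Rightarrow>
   ('s, 'f, 'r, 'o, 'a) interp \<Rightarrow> 'v set set \<Rightarrow> ('v set \<Rightarrow> 'a) \<Rightarrow> ('f, 'r, 'v) form \<Rightarrow> bool" where
  "satisfies S L I \<C> A \<phi> \<longleftrightarrow>
     (\<forall>U\<in>\<C>. \<phi> \<in> Forms L U \<longrightarrow> sub_le S (A U) (form_int S L I \<phi> U))"

definition no_signalling_model ::
  "('o, 'a, 'm) category_struct_scheme \<Rightarrow> ('s, 'f, 'r, 'v) language \<Rightarrow>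
   ('s, 'f, 'r, 'o, 'a) interp \<Rightarrow> 'v set set \<Rightarrow> ('f, 'r, 'v) form set \<Rightarrow> ('v set \<Rightarrow> 'a) \<Rightarrow> bool" where
  "no_signalling_model S L I \<C> \<Gamma> A \<longleftrightarrow>
     subpresheaf S L I \<C> A \<and> no_signalling S L I \<C> A \<and> (\<forall>\<psi>\<in>\<Gamma>. satisfies S L I \<C> A \<psi>)"

end

theory Submission
  imports Defs
begin

text \<open>
  By induction on derivations it suffices to treat the rule for a single context \<open>U\<close>: there
  \<open>A U\<close> lies below \<open>\<phi>\<close> because the interpretation models the theory, and one must
  transfer this to every other context \<open>V\<close> of \<open>\<phi>\<close>.  Since the restriction of \<open>A U\<close> to
  \<open>A (U \<inter> V)\<close> is a regular epimorphism, and those are orthogonal to monos, \<open>A (U \<inter> V)\<close>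
  lies below \<open>\<phi>\<close> too, hence so does \<open>A V\<close>.  This uses that the interpretations of \<open>\<phi>\<close> in
  contexts \<open>W \<subseteq> V\<close> correspond under pullback, which follows from Kripke--Joyal semantics.
\<close>

section \<open>Monos, regular epis and generalized elements in a category\<close>

context category
begin

lemma hom_Dom: "f \<in> hom S A B \<Longrightarrow> Dom S f = A"
  and hom_Cod: "f \<in> hom S A B \<Longrightarrow> Cod S f = B"
  by (simp_all add: hom_def)

lemma hom_Obj:
  assumes "f \<in> hom S A B"
  shows "A \<in> Obj S" and "B \<in> Obj S"
  using assms Dom_in_Obj Cod_in_Obj by (auto simp: hom_def)

text \<open>\<open>sub_le\<close> does not ask its left argument to be mono, so for an arbitrary
  arrow \<open>h\<close> into \<open>A\<close> it says that the generalized element \<open>h\<close>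
  at stage \<open>K\<close> belongs to the subobject \<open>m\<close>. Most facts about subobjects
  below take this form.\<close>

lemma sub_le_iff: "h \<in> hom S K A \<Longrightarrow> m \<in> hom S M A \<Longrightarrow> sub_le S h m \<longleftrightarrow> (\<exists>k \<in> hom S K M. m \<cdot> k = h)"
  by (simp add: sub_le_def hom_def)

lemma mono_arrow_iff:
  assumes "m \<in> hom S M A"
  shows "mono_arrow S m \<longleftrightarrow>
    (\<forall>K. \<forall>u \<in> hom S K M. \<forall>v \<in> hom S K M. m \<cdot> u = m \<cdot> v \<longrightarrow> u = v)"
  using assms by (simp add: mono_arrow_def hom_def)

lemma mono_cancel:
  assumes "mono_arrow S m" "m \<in> hom S M A" "u \<in> hom S K M" "v \<in> hom S K M" "m \<cdot> u = m \<cdot> v"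
  shows "u = v"
  using assms mono_arrow_iff by blast

lemma Sub_iff: "m \<in> Sub S A \<longleftrightarrow> mono_arrow S m \<and> m \<in> hom S (Dom S m) A"
  by (auto simp: Sub_def hom_def mono_arrow_def)

lemma SubI: "m \<in> hom S M A \<Longrightarrow> mono_arrow S m \<Longrightarrow> m \<in> Sub S A"
  by (simp add: Sub_def hom_def)

lemma Id_in_Sub: "A \<in> Obj S \<Longrightarrow> Id S A \<in> Sub S A"
  by (rule SubI[OF Id_in_hom]) (auto simp: mono_arrow_iff[OF Id_in_hom] Id_Comp)

lemma mono_Comp:
  assumes m: "mono_arrow S m" "m \<in> hom S A B" and n: "mono_arrow S n" "n \<in> hom S B C"
  shows "mono_arrow S (n \<cdot> m)"
  unfolding mono_arrow_iff[OF Comp_in_hom[OF m(2) n(2)]]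
proof (intro allI ballI impI)
  fix K u v assume uv: "u \<in> hom S K A" "v \<in> hom S K A" "n \<cdot> m \<cdot> u = n \<cdot> m \<cdot> v"
  then have "n \<cdot> (m \<cdot> u) = n \<cdot> (m \<cdot> v)"
    by (simp add: Comp_assoc[OF _ m(2) n(2)])
  then have "m \<cdot> u = m \<cdot> v"
    using mono_cancel[OF n] Comp_in_hom[OF _ m(2)] uv by blast
  then show "u = v" using mono_cancel[OF m] uv by blast
qed

text \<open>\<open>is_pullback\<close> hides the objects of the square behind existential
  quantifiers; those of the cospan are recovered because an arrow has only one domain and one
  codomain.\<close>

lemma pullbackE:
  assumes "is_pullback S f g p q" "f \<in> hom S A C" "g \<in> hom S B C"
  obtains P where "p \<in> hom S P A" "q \<in> hom S P B" "f \<cdot> p = g \<cdot> q"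
    "\<And>K u v. u \<in> hom S K A \<Longrightarrow> v \<in> hom S K B \<Longrightarrow> f \<cdot> u = g \<cdot> v \<Longrightarrow>
       \<exists>!h. h \<in> hom S K P \<and> p \<cdot> h = u \<and> q \<cdot> h = v"
proof -
  obtain A' B' C' P where *: "f \<in> hom S A' C'" "g \<in> hom S B' C'" "p \<in> hom S P A'" "q \<in> hom S P B'"
    "f \<cdot> p = g \<cdot> q"
    "\<forall>K. \<forall>u \<in> hom S K A'. \<forall>v \<in> hom S K B'. f \<cdot> u = g \<cdot> v \<longrightarrow>
       (\<exists>!h. h \<in> hom S K P \<and> p \<cdot> h = u \<and> q \<cdot> h = v)"
    using assms(1) unfolding is_pullback_def by blast
  have "A' = A" "B' = B" using * assms by (auto simp: hom_def)
  with * that show thesis by blast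
qed

lemma regular_epiE:
  assumes "regular_epi S e" "e \<in> hom S B Q"
  obtains A f g where "f \<in> hom S A B" "g \<in> hom S A B" "e \<cdot> f = e \<cdot> g"
    "\<And>K u. u \<in> hom S B K \<Longrightarrow> u \<cdot> f = u \<cdot> g \<Longrightarrow> \<exists>!h. h \<in> hom S Q K \<and> h \<cdot> e = u"
proof -
  obtain f g A B' Q' where *: "f \<in> hom S A B'" "g \<in> hom S A B'" "e \<in> hom S B' Q'" "e \<cdot> f = e \<cdot> g"
    "\<forall>K. \<forall>u \<in> hom S B' K. u \<cdot> f = u \<cdot> g \<longrightarrow> (\<exists>!h. h \<in> hom S Q' K \<and> h \<cdot> e = u)"
    using assms(1) unfolding regular_epi_def is_coequalizer_def by blast
  have "B' = B" "Q' = Q" using * assms by (auto simp: hom_def)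
  with * that show thesis by blast
qed

text \<open>\<open>u\<close> and \<open>v\<close> both factor the arrow \<open>u \<cdot> e\<close>
  through the coequalizer \<open>e\<close>, and such a factorization is unique.\<close>

lemma regular_epi_cancel:
  assumes "regular_epi S e" "e \<in> hom S B Q" "u \<in> hom S Q K" "v \<in> hom S Q K" "u \<cdot> e = v \<cdot> e"
  shows "u = v"
proof -
  obtain A f g where fg: "f \<in> hom S A B" "g \<in> hom S A B" "e \<cdot> f = e \<cdot> g"
    "\<And>K u. u \<in> hom S B K \<Longrightarrow> u \<cdot> f = u \<cdot> g \<Longrightarrow> \<exists>!h. h \<in> hom S Q K \<and> h \<cdot> e = u"
    by (rule regular_epiE[OF assms(1,2)]) (rule that; blast)
  have "u \<cdot> e \<cdot> f = u \<cdot> e \<cdot> g"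
    using fg(3) Comp_assoc[OF fg(1) assms(2,3)] Comp_assoc[OF fg(2) assms(2,3)] by simp
  then have "\<exists>!h. h \<in> hom S Q K \<and> h \<cdot> e = u \<cdot> e"
    using fg(4) Comp_in_hom[OF assms(2,3)] by blast
  then show ?thesis
    by (rule ex1E) (use assms in metis)
qed

text \<open>Diagonal fill-in of a regular epi against a mono: the factorization \<open>k\<close> of
  \<open>h \<cdot> e\<close> through \<open>m\<close> coequalizes the pair that \<open>e\<close>
  coequalizes, because \<open>m\<close> can be cancelled, and so descends along \<open>e\<close>.
  Read with \<open>e\<close> as a cover, membership in a subobject is a local property.\<close>

lemma sub_le_descend:
  assumes e: "regular_epi S e" "e \<in> hom S K' K" and h: "h \<in> hom S K A"
    and m: "m \<in> Sub S A" and le: "sub_le S (h \<cdot> e) m"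
  shows "sub_le S h m"
proof -
  let ?M = "Dom S m"
  have mh: "m \<in> hom S ?M A" and mm: "mono_arrow S m" using m by (auto simp: Sub_iff)
  obtain k where k: "k \<in> hom S K' ?M" "m \<cdot> k = h \<cdot> e"
    using le sub_le_iff[OF Comp_in_hom[OF e(2) h] mh] by blast
  obtain B f g where fg: "f \<in> hom S B K'" "g \<in> hom S B K'" "e \<cdot> f = e \<cdot> g"
    "\<And>C u. u \<in> hom S K' C \<Longrightarrow> u \<cdot> f = u \<cdot> g \<Longrightarrow> \<exists>!h. h \<in> hom S K C \<and> h \<cdot> e = u"
    by (rule regular_epiE[OF e]) (rule that; blast)
  have "m \<cdot> (k \<cdot> f) = m \<cdot> (k \<cdot> g)"
    using Comp_assoc[OF fg(1) k(1) mh] Comp_assoc[OF fg(2) k(1) mh] k(2) fg(3)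
      Comp_assoc[OF fg(1) e(2) h] Comp_assoc[OF fg(2) e(2) h] by simp
  then have "k \<cdot> f = k \<cdot> g"
    using mono_cancel[OF mm mh] Comp_in_hom fg(1,2) k(1) by blast
  then obtain d where d: "d \<in> hom S K ?M" "d \<cdot> e = k" using fg(4) k(1) by blast
  have "m \<cdot> d \<cdot> e = h \<cdot> e" using Comp_assoc[OF e(2) d(1) mh] d k by simp
  then have "m \<cdot> d = h" using regular_epi_cancel[OF e Comp_in_hom[OF d(1) mh] h] by blast
  with d show ?thesis using sub_le_iff[OF h mh] by blast
qed

lemma sub_le_Comp:
  assumes "h \<in> hom S K A" "m \<in> hom S M A" "sub_le S h m" "e \<in> hom S K' K"
  shows "sub_le S (h \<cdot> e) m"
proof -
  obtain k where "k \<in> hom S K M" "m \<cdot> k = h" using assms sub_le_iff by blast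
  then show ?thesis
    using sub_le_iff[OF Comp_in_hom[OF assms(4,1)] assms(2)] Comp_in_hom[OF assms(4)]
      Comp_assoc[OF assms(4) _ assms(2)] by auto
qed

lemma sub_le_trans:
  assumes "h \<in> hom S K A" "m \<in> hom S M A" "n \<in> hom S N A" "sub_le S h m" "sub_le S m n"
  shows "sub_le S h n"
proof -
  obtain k where "k \<in> hom S K M" "m \<cdot> k = h" using assms sub_le_iff by blast
  then show ?thesis using sub_le_Comp[OF assms(2,3,5)] by blast
qed

end


section \<open>Limits and images in a regular category\<close>

context regular_category
begin

section \<open>Existence of finite limits\<close>

lemma limit_exists:
  fixes J :: "nat set"
  shows "is_diagram S J D E \<Longrightarrow> finite J \<Longrightarrow> finite E \<Longrightarrow> \<exists>P p. is_limit S J D E P p"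
  using finite_limits unfolding has_finite_limits_def by blast

lemma is_limitD:
  assumes "is_limit S J D E P p"
  shows "P \<in> Obj S"
    and "j \<in> J \<Longrightarrow> p j \<in> hom S P (D j)"
    and "(i, a, j) \<in> E \<Longrightarrow> a \<cdot> p i = p j"
    and "is_cone S J D E K q \<Longrightarrow> \<exists>!h. h \<in> hom S K P \<and> (\<forall>j\<in>J. p j \<cdot> h = q j)"
proof -
  have cone: "is_cone S J D E P p" using assms unfolding is_limit_def by blast
  then show "P \<in> Obj S" and "j \<in> J \<Longrightarrow> p j \<in> hom S P (D j)"
    and "(i, a, j) \<in> E \<Longrightarrow> a \<cdot> p i = p j"
    unfolding is_cone_def by auto
  show "is_cone S J D E K q \<Longrightarrow> \<exists>!h. h \<in> hom S K P \<and> (\<forall>j\<in>J. p j \<cdot> h = q j)"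
    using assms unfolding is_limit_def by blast
qed

text \<open>\<open>has_finite_limits\<close> provides limits only for vertices in
  \<open>nat\<close>, so the index set is carried into \<open>nat\<close> by an injection
  \<open>f\<close> and the family is read back through \<open>inv_into J f\<close>.\<close>

lemma product_exists:
  assumes "finite J" "\<forall>i\<in>J. D i \<in> Obj S"
  shows "\<exists>P p. is_product S J D P p"
proof -
  obtain f :: "_ \<Rightarrow> nat" where f: "inj_on f J"
    using finite_imp_inj_to_nat_seg[OF assms(1)] by blast
  let ?D = "\<lambda>j. D (inv_into J f j)"
  have D: "?D (f i) = D i" if "i \<in> J" for i using f that by simp
  have "is_diagram S (f ` J) ?D {}"
    using assms(2) D by (auto simp: is_diagram_def)
  then obtain P p where "is_limit S (f ` J) ?D {} P p"
    using limit_exists[of "f ` J" ?D "{}"] assms(1) by auto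
  note P = is_limitD[OF this]
  have "is_product S J D P (\<lambda>i. p (f i))"
    unfolding is_product_def is_limit_def
  proof (intro conjI allI impI)
    show "is_cone S J D {} P (\<lambda>i. p (f i))"
      using P(1) P(2)[OF imageI] D by (auto simp: is_cone_def)
  next
    fix K q assume "is_cone S J D {} K q"
    then have "is_cone S (f ` J) ?D {} K (\<lambda>j. q (inv_into J f j))"
      using D f by (auto simp: is_cone_def)
    from P(4)[OF this] show "\<exists>!h. h \<in> hom S K P \<and> (\<forall>i\<in>J. p (f i) \<cdot> h = q i)"
      using f by simp
  qed
  then show ?thesis by blast
qed

lemma pullback_exists:
  assumes f: "f \<in> hom S A C" and g: "g \<in> hom S B C"
  shows "\<exists>p q. is_pullback S f g p q"
proof -
  \<comment> \<open>The shape is a cospan: vertex 0 carries \<open>A\<close>, vertex 1 carries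
    \<open>B\<close>, and the default value \<open>C\<close> serves vertex 2, where both edges
    end.\<close>
  let ?D = "(\<lambda>_. C)(0 := A, Suc 0 := B)"
  let ?J = "{0, Suc 0, Suc (Suc 0)}"
  let ?E = "{(0, f, Suc (Suc 0)), (Suc 0, g, Suc (Suc 0))}"
  have "is_diagram S ?J ?D ?E"
    using f g hom_Obj by (auto simp: is_diagram_def)
  then obtain P p where "is_limit S ?J ?D ?E P p"
    using limit_exists[of ?J ?D ?E] by auto
  note P = is_limitD[OF this]
  have p0: "p 0 \<in> hom S P A" using P(2)[of 0] by simp
  have p1: "p (Suc 0) \<in> hom S P B" using P(2)[of "Suc 0"] by simp
  have eqs: "f \<cdot> p 0 = p (Suc (Suc 0))" "g \<cdot> p (Suc 0) = p (Suc (Suc 0))" using P(3) by simp_all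
  have univ: "\<exists>!h. h \<in> hom S K P \<and> p 0 \<cdot> h = u \<and> p (Suc 0) \<cdot> h = v"
    if u: "u \<in> hom S K A" and v: "v \<in> hom S K B" and uv: "f \<cdot> u = g \<cdot> v" for K u v
  proof -
    let ?q = "(\<lambda>_. f \<cdot> u)(0 := u, Suc 0 := v)"
    have "is_cone S ?J ?D ?E K ?q"
      using u v uv hom_Obj(1)[OF u] Comp_in_hom[OF u f] by (auto simp: is_cone_def)
    from P(4)[OF this]
    have ex: "\<exists>!h. h \<in> hom S K P \<and> p 0 \<cdot> h = u \<and> p (Suc 0) \<cdot> h = v \<and> p (Suc (Suc 0)) \<cdot> h = f \<cdot> u"
      by simp
    have "p (Suc (Suc 0)) \<cdot> h = f \<cdot> u" if "h \<in> hom S K P" "p 0 \<cdot> h = u" for h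
      using that eqs(1) Comp_assoc[OF that(1) p0 f] by simp
    with ex show ?thesis by metis
  qed
  have "is_pullback S f g (p 0) (p (Suc 0))"
    unfolding is_pullback_def
    by (rule exI[of _ A], rule exI[of _ B], rule exI[of _ C], rule exI[of _ P])
      (use f g p0 p1 eqs univ in simp)
  then show ?thesis by blast
qed

lemma equalizer_exists:
  assumes f: "f \<in> hom S A B" and g: "g \<in> hom S A B"
  shows "\<exists>e. is_equalizer S f g e"
proof -
  let ?D = "(\<lambda>_. B)(0 := A)"
  let ?J = "{0, Suc 0}"
  let ?E = "{(0, f, Suc 0), (0, g, Suc 0)}"
  have "is_diagram S ?J ?D ?E"
    using f g hom_Obj by (auto simp: is_diagram_def)
  then obtain P p where "is_limit S ?J ?D ?E P p"
    using limit_exists[of ?J ?D ?E] by auto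
  note P = is_limitD[OF this]
  have p0: "p 0 \<in> hom S P A" using P(2)[of 0] by simp
  have eqs: "f \<cdot> p 0 = p (Suc 0)" "g \<cdot> p 0 = p (Suc 0)" using P(3) by simp_all
  have univ: "\<exists>!h. h \<in> hom S K P \<and> p 0 \<cdot> h = u"
    if u: "u \<in> hom S K A" and uv: "f \<cdot> u = g \<cdot> u" for K u
  proof -
    let ?q = "(\<lambda>_. f \<cdot> u)(0 := u)"
    have "is_cone S ?J ?D ?E K ?q"
      using u uv hom_Obj(1)[OF u] Comp_in_hom[OF u f] by (auto simp: is_cone_def)
    from P(4)[OF this]
    have ex: "\<exists>!h. h \<in> hom S K P \<and> p 0 \<cdot> h = u \<and> p (Suc 0) \<cdot> h = f \<cdot> u"
      by simp
    have "p (Suc 0) \<cdot> h = f \<cdot> u" if "h \<in> hom S K P" "p 0 \<cdot> h = u" for h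
      using that eqs(1) Comp_assoc[OF that(1) p0 f] by simp
    with ex show ?thesis by metis
  qed
  have "is_equalizer S f g (p 0)"
    unfolding is_equalizer_def
    by (rule exI[of _ A], rule exI[of _ B], rule exI[of _ P]) (use f g p0 eqs univ in simp)
  then show ?thesis by blast
qed

section \<open>Operations on subobjects through their generalized elements\<close>

lemma pullback_mono:
  assumes "is_pullback S f m p q" "f \<in> hom S A C" "m \<in> Sub S C"
  shows "p \<in> Sub S A"
    and "\<And>K h. h \<in> hom S K A \<Longrightarrow> sub_le S h p \<longleftrightarrow> sub_le S (f \<cdot> h) m"
proof -
  let ?M = "Dom S m"
  have m: "m \<in> hom S ?M C" "mono_arrow S m" using assms(3) by (auto simp: Sub_iff)
  obtain P where P: "p \<in> hom S P A" "q \<in> hom S P ?M" "f \<cdot> p = m \<cdot> q"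
    "\<And>K u v. u \<in> hom S K A \<Longrightarrow> v \<in> hom S K ?M \<Longrightarrow> f \<cdot> u = m \<cdot> v \<Longrightarrow>
       \<exists>!h. h \<in> hom S K P \<and> p \<cdot> h = u \<and> q \<cdot> h = v"
    by (rule pullbackE[OF assms(1,2) m(1)]) (rule that; blast)
  have square: "f \<cdot> (p \<cdot> u) = m \<cdot> (q \<cdot> u)" if "u \<in> hom S K P" for u K
    using Comp_assoc[OF that P(1) assms(2)] Comp_assoc[OF that P(2) m(1)] P(3) by simp
  \<comment> \<open>The first leg determines the second: \<open>m\<close> can be cancelled, so
    \<open>p \<cdot> u = p \<cdot> v\<close> forces
    \<open>q \<cdot> u = q \<cdot> v\<close>.\<close>
  have "mono_arrow S p"
    unfolding mono_arrow_iff[OF P(1)]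
  proof (intro allI ballI impI)
    fix K u v assume uv: "u \<in> hom S K P" "v \<in> hom S K P" "p \<cdot> u = p \<cdot> v"
    have fu: "f \<cdot> (p \<cdot> u) = m \<cdot> (q \<cdot> u)" and "f \<cdot> (p \<cdot> v) = m \<cdot> (q \<cdot> v)"
      using square uv by blast+
    then have "m \<cdot> (q \<cdot> u) = m \<cdot> (q \<cdot> v)" using uv(3) by simp
    then have "q \<cdot> u = q \<cdot> v"
      using mono_cancel[OF m(2,1) Comp_in_hom[OF uv(1) P(2)] Comp_in_hom[OF uv(2) P(2)]] by blast
    moreover have "\<exists>!h. h \<in> hom S K P \<and> p \<cdot> h = p \<cdot> u \<and> q \<cdot> h = q \<cdot> u"
      using P(4)[OF Comp_in_hom[OF uv(1) P(1)] Comp_in_hom[OF uv(1) P(2)] fu] .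
    ultimately show "u = v" using uv by (elim ex1E) metis
  qed
  then show "p \<in> Sub S A" using SubI[OF P(1)] by blast
  fix K h assume h: "h \<in> hom S K A"
  show "sub_le S h p \<longleftrightarrow> sub_le S (f \<cdot> h) m"
    unfolding sub_le_iff[OF h P(1)] sub_le_iff[OF Comp_in_hom[OF h assms(2)] m(1)]
  proof
    assume "\<exists>k\<in>hom S K P. p \<cdot> k = h"
    then obtain k where k: "k \<in> hom S K P" "p \<cdot> k = h" by blast
    then have "m \<cdot> (q \<cdot> k) = f \<cdot> h" using square[OF k(1)] by simp
    then show "\<exists>k\<in>hom S K ?M. m \<cdot> k = f \<cdot> h" using Comp_in_hom[OF k(1) P(2)] by blast
  next
    assume "\<exists>k\<in>hom S K ?M. m \<cdot> k = f \<cdot> h"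
    then obtain k where k: "k \<in> hom S K ?M" "f \<cdot> h = m \<cdot> k" by auto
    show "\<exists>k\<in>hom S K P. p \<cdot> k = h" using P(4)[OF h k] by blast
  qed
qed

text \<open>The second part replaces the Hilbert choice in \<open>sub_pullback\<close> by a
  description of membership. \<open>sub_equalizer\<close>, \<open>sub_meet\<close> and
  \<open>sub_image\<close> get such descriptions as well, which supply the clauses of the forcing
  relation.\<close>

lemma sub_pullback:
  assumes "f \<in> hom S A C" "m \<in> Sub S C"
  shows "sub_pullback S f m \<in> Sub S A"
    and "h \<in> hom S K A \<Longrightarrow> sub_le S h (sub_pullback S f m) \<longleftrightarrow> sub_le S (f \<cdot> h) m"
proof -
  have "\<exists>p q. is_pullback S f m p q"
    using pullback_exists assms Sub_iff by blast
  then have "\<exists>q. is_pullback S f m (sub_pullback S f m) q"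
    unfolding sub_pullback_def by (rule someI_ex)
  then obtain q where q: "is_pullback S f m (sub_pullback S f m) q" by blast
  from pullback_mono[OF q assms]
  show "sub_pullback S f m \<in> Sub S A"
    "h \<in> hom S K A \<Longrightarrow> sub_le S h (sub_pullback S f m) \<longleftrightarrow> sub_le S (f \<cdot> h) m"
    by blast+
qed

lemma sub_equalizer:
  assumes f: "f \<in> hom S A B" and g: "g \<in> hom S A B"
  shows "sub_equalizer S f g \<in> Sub S A"
    and "h \<in> hom S K A \<Longrightarrow> sub_le S h (sub_equalizer S f g) \<longleftrightarrow> f \<cdot> h = g \<cdot> h"
proof -
  define e where "e = sub_equalizer S f g"
  have "is_equalizer S f g e"
    unfolding e_def sub_equalizer_def using equalizer_exists[OF f g] by (rule someI_ex)
  then obtain A' B' P where *: "f \<in> hom S A' B'" "e \<in> hom S P A'" "f \<cdot> e = g \<cdot> e"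
    "\<forall>K. \<forall>u \<in> hom S K A'. f \<cdot> u = g \<cdot> u \<longrightarrow> (\<exists>!h. h \<in> hom S K P \<and> e \<cdot> h = u)"
    unfolding is_equalizer_def by blast
  then have "A' = A" using f by (auto simp: hom_def)
  with * have e: "e \<in> hom S P A" and
    u: "\<And>K u. u \<in> hom S K A \<Longrightarrow> f \<cdot> u = g \<cdot> u \<Longrightarrow> \<exists>!h. h \<in> hom S K P \<and> e \<cdot> h = u" by blast+
  have eq: "f \<cdot> (e \<cdot> k) = g \<cdot> (e \<cdot> k)" if "k \<in> hom S K P" for k K
    using Comp_assoc[OF that e f] Comp_assoc[OF that e g] *(3) by simp
  have "mono_arrow S e"
    unfolding mono_arrow_iff[OF e]
  proof (intro allI ballI impI)
    fix K k l assume kl: "k \<in> hom S K P" "l \<in> hom S K P" "e \<cdot> k = e \<cdot> l"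
    then show "k = l" using u[OF Comp_in_hom[OF kl(1) e] eq[OF kl(1)]] by auto
  qed
  then show "sub_equalizer S f g \<in> Sub S A" using SubI[OF e] by (simp add: e_def)
  assume h: "h \<in> hom S K A"
  then have "sub_le S h e \<longleftrightarrow> f \<cdot> h = g \<cdot> h"
    unfolding sub_le_iff[OF h e] using u[OF h] eq by blast
  then show "sub_le S h (sub_equalizer S f g) \<longleftrightarrow> f \<cdot> h = g \<cdot> h" by (simp add: e_def)
qed

text \<open>By induction on \<open>M\<close>: the empty meet is the identity, and a further
  \<open>n\<close> is met with \<open>m\<close> by pulling \<open>m\<close> back along
  \<open>n\<close> and composing with \<open>n\<close>.\<close>

lemma meet_exists:
  assumes "finite M" "M \<subseteq> Sub S A" "A \<in> Obj S"
  shows "\<exists>m \<in> Sub S A. \<forall>K. \<forall>h \<in> hom S K A. sub_le S h m \<longleftrightarrow> (\<forall>n\<in>M. sub_le S h n)"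
  using assms(1,2)
proof (induction M)
  case empty
  have "sub_le S h (Id S A)" if "h \<in> hom S K A" for h K
    unfolding sub_le_iff[OF that Id_in_hom[OF assms(3)]] using that Id_Comp by blast
  then show ?case using Id_in_Sub[OF assms(3)] by auto
next
  case (insert n M)
  then obtain m where m: "m \<in> Sub S A"
    "\<And>K h. h \<in> hom S K A \<Longrightarrow> sub_le S h m \<longleftrightarrow> (\<forall>n\<in>M. sub_le S h n)" by auto
  have n: "n \<in> Sub S A" using insert by simp
  let ?p = "sub_pullback S n m" and ?N = "Dom S n"
  have nh: "n \<in> hom S ?N A" "mono_arrow S n" using n by (auto simp: Sub_iff)
  note p = sub_pullback[OF nh(1) m(1)]
  have ph: "?p \<in> hom S (Dom S ?p) ?N" "mono_arrow S ?p" using p(1) by (auto simp: Sub_iff)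
  have mh: "m \<in> hom S (Dom S m) A" using m(1) by (simp add: Sub_iff)
  let ?r = "n \<cdot> ?p"
  have r: "?r \<in> hom S (Dom S ?p) A" using Comp_in_hom[OF ph(1) nh(1)] .
  have "sub_le S h ?r \<longleftrightarrow> sub_le S h n \<and> sub_le S h m" if h: "h \<in> hom S K A" for h K
  proof
    assume "sub_le S h ?r"
    then obtain k where k: "k \<in> hom S K (Dom S ?p)" "?r \<cdot> k = h"
      unfolding sub_le_iff[OF h r] by blast
    have pk: "?p \<cdot> k \<in> hom S K ?N" using Comp_in_hom[OF k(1) ph(1)] .
    have npk: "n \<cdot> (?p \<cdot> k) = h" using k Comp_assoc[OF k(1) ph(1) nh(1)] by simp
    have "sub_le S (?p \<cdot> k) ?p" using sub_le_iff[OF pk ph(1)] k(1) by blast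
    then have "sub_le S h m" using p(2)[OF pk] npk by simp
    then show "sub_le S h n \<and> sub_le S h m" using sub_le_iff[OF h nh(1)] pk npk by blast
  next
    assume *: "sub_le S h n \<and> sub_le S h m"
    then obtain k where k: "k \<in> hom S K ?N" "n \<cdot> k = h" using sub_le_iff[OF h nh(1)] by blast
    then have "sub_le S k ?p" using * p(2) by simp
    then obtain l where l: "l \<in> hom S K (Dom S ?p)" "?p \<cdot> l = k"
      using sub_le_iff[OF k(1) ph(1)] by blast
    then have "?r \<cdot> l = h" using k Comp_assoc[OF l(1) ph(1) nh(1)] by simp
    then show "sub_le S h ?r" using sub_le_iff[OF h r] l by blast
  qed
  moreover have "?r \<in> Sub S A"
    using SubI[OF r mono_Comp[OF ph(2,1) nh(2,1)]] .
  ultimately show ?case using m(2) by (intro bexI[of _ ?r]) auto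
qed

lemma sub_meet:
  assumes "finite M" "M \<subseteq> Sub S A" "A \<in> Obj S"
  shows "sub_meet S A M \<in> Sub S A"
    and "h \<in> hom S K A \<Longrightarrow> sub_le S h (sub_meet S A M) \<longleftrightarrow> (\<forall>n\<in>M. sub_le S h n)"
proof -
  let ?P = "\<lambda>m. m \<in> Sub S A \<and> (\<forall>n\<in>M. sub_le S m n) \<and>
     (\<forall>k \<in> Sub S A. (\<forall>n\<in>M. sub_le S k n) \<longrightarrow> sub_le S k m)"
  have Subh: "m \<in> hom S (Dom S m) A" if "m \<in> Sub S A" for m using that by (simp add: Sub_iff)
  have refl: "sub_le S m m" if "m \<in> Sub S A" for m
    using Comp_Id[OF Subh[OF that]] Id_in_hom hom_Obj(1)[OF Subh[OF that]] by (auto simp: sub_le_def)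
  obtain m where m: "m \<in> Sub S A"
    "\<And>K h. h \<in> hom S K A \<Longrightarrow> sub_le S h m \<longleftrightarrow> (\<forall>n\<in>M. sub_le S h n)"
    using meet_exists[OF assms] by blast
  have "?P m" using m refl Subh by blast
  then have P: "?P (sub_meet S A M)" unfolding sub_meet_def by (rule someI)
  then show *: "sub_meet S A M \<in> Sub S A" by blast
  assume h: "h \<in> hom S K A"
  \<comment> \<open>The definition of \<open>sub_meet\<close> compares only with subobjects. An
    arbitrary element \<open>h\<close> below all of \<open>M\<close> reaches the chosen meet through
    \<open>m\<close>, which has the stronger property and is itself a subobject.\<close>
  have "sub_le S m (sub_meet S A M)" using P \<open>?P m\<close> by blast
  then show "sub_le S h (sub_meet S A M) \<longleftrightarrow> (\<forall>n\<in>M. sub_le S h n)"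
    using P m(2)[OF h] sub_le_trans[OF h Subh[OF m(1)] Subh[OF *]]
      sub_le_trans[OF h Subh[OF *] Subh] assms(2) by blast
qed

section \<open>Regular epis as covers, and images\<close>

lemma regular_epi_lift:
  assumes e: "regular_epi S e" "e \<in> hom S A Q" and u: "u \<in> hom S K Q"
  obtains K' r a where "regular_epi S r" "r \<in> hom S K' K" "a \<in> hom S K' A" "u \<cdot> r = e \<cdot> a"
proof -
  \<comment> \<open>This pullback supplies both arrows: its first leg is the cover \<open>r\<close>,
    a regular epi by stability, and its second leg is the lift \<open>a\<close> of \<open>u\<close>
    on this cover.\<close>
  obtain p q where pq: "is_pullback S u e p q" using pullback_exists[OF u e(2)] by blast
  show thesis
    by (rule pullbackE[OF pq u e(2)]) (rule that[OF regular_epi_stable[OF pq e(1)]])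
qed

text \<open>
  The second factor of the coequalizer of the kernel pair is mono: two elements which it
  identifies lift, on a common cover, to elements related by the kernel pair.
\<close>

lemma image_exists:
  assumes f: "f \<in> hom S A B"
  shows "\<exists>m. mono_arrow S m \<and> (\<exists>e. regular_epi S e \<and> Cod S e = Dom S m \<and> m \<cdot> e = f)"
proof -
  obtain p q where pq: "is_pullback S f f p q" using pullback_exists[OF f f] by blast
  then obtain e where ce: "is_coequalizer S p q e" using kernel_pair_coequalizer by blast
  then have re: "regular_epi S e" unfolding regular_epi_def by blast
  obtain P where P: "p \<in> hom S P A" "q \<in> hom S P A" "f \<cdot> p = f \<cdot> q"
    "\<And>K u v. u \<in> hom S K A \<Longrightarrow> v \<in> hom S K A \<Longrightarrow> f \<cdot> u = f \<cdot> v \<Longrightarrow>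
       \<exists>!h. h \<in> hom S K P \<and> p \<cdot> h = u \<and> q \<cdot> h = v"
    by (rule pullbackE[OF pq f f]) (rule that; blast)
  obtain P' A' Q where *: "p \<in> hom S P' A'" "e \<in> hom S A' Q" "e \<cdot> p = e \<cdot> q"
    "\<forall>K. \<forall>u \<in> hom S A' K. u \<cdot> p = u \<cdot> q \<longrightarrow> (\<exists>!h. h \<in> hom S Q K \<and> h \<cdot> e = u)"
    using ce unfolding is_coequalizer_def by blast
  have "A' = A" using *(1) P(1) by (auto simp: hom_def)
  with * have e: "e \<in> hom S A Q" by simp
  obtain m where m: "m \<in> hom S Q B" "m \<cdot> e = f"
    using *(4) P(3) f \<open>A' = A\<close> by blast
  have "mono_arrow S m"
    unfolding mono_arrow_iff[OF m(1)]
  proof (intro allI ballI impI)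
    fix K u v assume u: "u \<in> hom S K Q" and v: "v \<in> hom S K Q" and uv: "m \<cdot> u = m \<cdot> v"
    obtain K1 r a where r: "regular_epi S r" "r \<in> hom S K1 K" and a: "a \<in> hom S K1 A" "u \<cdot> r = e \<cdot> a"
      by (rule regular_epi_lift[OF re e u])
    \<comment> \<open>\<open>v\<close> is lifted over the stage \<open>K1\<close> that already
      carries the lift of \<open>u\<close>, so that both lifts are available at the common stage
      \<open>K2\<close>.\<close>
    obtain K2 s b where s: "regular_epi S s" "s \<in> hom S K2 K1"
      and b: "b \<in> hom S K2 A" "v \<cdot> r \<cdot> s = e \<cdot> b"
      by (rule regular_epi_lift[OF re e Comp_in_hom[OF r(2) v]])
    have as: "a \<cdot> s \<in> hom S K2 A" using Comp_in_hom[OF s(2) a(1)] .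
    have eas: "e \<cdot> (a \<cdot> s) = u \<cdot> r \<cdot> s" using a Comp_assoc[OF s(2) a(1) e] by simp
    have "f \<cdot> (a \<cdot> s) = m \<cdot> (e \<cdot> (a \<cdot> s))" using Comp_assoc[OF as e m(1)] m(2) by simp
    also have "\<dots> = m \<cdot> (u \<cdot> r) \<cdot> s" using eas Comp_assoc[OF s(2) Comp_in_hom[OF r(2) u] m(1)] by simp
    also have "m \<cdot> (u \<cdot> r) = m \<cdot> (v \<cdot> r)"
      using uv Comp_assoc[OF r(2) u m(1)] Comp_assoc[OF r(2) v m(1)] by simp
    also have "m \<cdot> (v \<cdot> r) \<cdot> s = m \<cdot> (e \<cdot> b)"
      using b Comp_assoc[OF s(2) Comp_in_hom[OF r(2) v] m(1)] by simp
    also have "\<dots> = f \<cdot> b" using Comp_assoc[OF b(1) e m(1)] m(2) by simp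
    finally obtain w where w: "w \<in> hom S K2 P" "p \<cdot> w = a \<cdot> s" "q \<cdot> w = b"
      using P(4)[OF as b(1)] by blast
    then have "e \<cdot> (a \<cdot> s) = e \<cdot> b"
      using Comp_assoc[OF w(1) P(1) e] Comp_assoc[OF w(1) P(2) e] *(3) by simp
    then have "u \<cdot> r \<cdot> s = v \<cdot> r \<cdot> s" using eas b by simp
    then have "u \<cdot> r = v \<cdot> r"
      using regular_epi_cancel[OF s Comp_in_hom[OF r(2) u] Comp_in_hom[OF r(2) v]] by blast
    then show "u = v" using regular_epi_cancel[OF r u v] by blast
  qed
  moreover have "Cod S e = Dom S m" using hom_Cod[OF e] hom_Dom[OF m(1)] by simp
  ultimately show ?thesis using re m(2) by blast
qed

text \<open>An element of the image lifts along the regular epi part \<open>e\<close> after passing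
  to a cover; conversely, an element that lifts on a cover \<open>r\<close> belongs to the image
  there, and \<open>sub_le_descend\<close> removes the cover. This is the local existence expressed
  by the clause for \<open>Ex\<close> in \<open>forces\<close>.\<close>

lemma sub_image:
  assumes f: "f \<in> hom S A B"
  shows "sub_image S f \<in> Sub S B"
    and "h \<in> hom S K B \<Longrightarrow> sub_le S h (sub_image S f) \<longleftrightarrow>
      (\<exists>K' r a. regular_epi S r \<and> r \<in> hom S K' K \<and> a \<in> hom S K' A \<and> h \<cdot> r = f \<cdot> a)"
proof -
  define m where "m = sub_image S f"
  have "mono_arrow S m \<and> (\<exists>e. regular_epi S e \<and> Cod S e = Dom S m \<and> m \<cdot> e = f)"
    unfolding m_def sub_image_def using image_exists[OF f] by (rule someI_ex)
  then obtain e where mono: "mono_arrow S m" and re: "regular_epi S e"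
    and ce: "Cod S e = Dom S m" and me: "m \<cdot> e = f" by blast
  have m': "m \<in> hom S (Dom S m) (Cod S m)" using mono by (simp add: mono_arrow_def hom_def)
  have e': "e \<in> hom S (Dom S e) (Dom S m)"
    using re ce unfolding regular_epi_def is_coequalizer_def by (auto simp: hom_def)
  \<comment> \<open>The choice made by \<open>sub_image\<close> mentions neither \<open>A\<close>
    nor \<open>B\<close>; they are recovered from \<open>m \<cdot> e = f\<close>.\<close>
  have "Dom S e = A" "Cod S m = B"
    using Comp_in_hom[OF e' m'] me f by (auto simp: hom_def)
  with m' e' have m: "m \<in> hom S (Dom S m) B" and e: "e \<in> hom S A (Dom S m)" by simp_all
  show Sub: "sub_image S f \<in> Sub S B" using SubI[OF m mono] by (simp add: m_def)
  assume h: "h \<in> hom S K B"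
  show "sub_le S h (sub_image S f) \<longleftrightarrow>
      (\<exists>K' r a. regular_epi S r \<and> r \<in> hom S K' K \<and> a \<in> hom S K' A \<and> h \<cdot> r = f \<cdot> a)"
    unfolding m_def[symmetric]
  proof
    assume "sub_le S h m"
    then obtain k where k: "k \<in> hom S K (Dom S m)" "m \<cdot> k = h" using sub_le_iff[OF h m] by blast
    obtain K' r a where r: "regular_epi S r" "r \<in> hom S K' K" "a \<in> hom S K' A" "k \<cdot> r = e \<cdot> a"
      by (rule regular_epi_lift[OF re e k(1)])
    have "h \<cdot> r = f \<cdot> a"
      using Comp_assoc[OF r(2) k(1) m] Comp_assoc[OF r(3) e m] k me r(4) by simp
    with r show "\<exists>K' r a. regular_epi S r \<and> r \<in> hom S K' K \<and> a \<in> hom S K' A \<and> h \<cdot> r = f \<cdot> a"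
      by blast
  next
    assume "\<exists>K' r a. regular_epi S r \<and> r \<in> hom S K' K \<and> a \<in> hom S K' A \<and> h \<cdot> r = f \<cdot> a"
    then obtain K' r a where r: "regular_epi S r" "r \<in> hom S K' K" "a \<in> hom S K' A" "h \<cdot> r = f \<cdot> a"
      by blast
    have "m \<cdot> (e \<cdot> a) = h \<cdot> r" using Comp_assoc[OF r(3) e m] me r(4) by simp
    then have "sub_le S (h \<cdot> r) m"
      using sub_le_iff[OF Comp_in_hom[OF r(2) h] m] Comp_in_hom[OF r(3) e] by blast
    then show "sub_le S h m" using sub_le_descend[OF r(1,2) h] Sub by (simp add: m_def)
  qed
qed

section \<open>Chosen finite products and tuples\<close>

lemma prod_cone:
  assumes "finite J" "\<forall>i\<in>J. D i \<in> Obj S"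
  shows "prod_ob S J D \<in> Obj S"
    and "i \<in> J \<Longrightarrow> prod_pr S J D i \<in> hom S (prod_ob S J D) (D i)"
    and "K \<in> Obj S \<Longrightarrow> \<forall>i\<in>J. q i \<in> hom S K (D i) \<Longrightarrow>
      \<exists>!h. h \<in> hom S K (prod_ob S J D) \<and> (\<forall>i\<in>J. prod_pr S J D i \<cdot> h = q i)"
proof -
  have "\<exists>Pp. is_product S J D (fst Pp) (snd Pp)" using product_exists[OF assms] by auto
  then have "is_product S J D (prod_ob S J D) (prod_pr S J D)"
    unfolding prod_ob_def prod_pr_def prod_cone_def by (rule someI_ex)
  then show "prod_ob S J D \<in> Obj S"
    "i \<in> J \<Longrightarrow> prod_pr S J D i \<in> hom S (prod_ob S J D) (D i)"
    "K \<in> Obj S \<Longrightarrow> \<forall>i\<in>J. q i \<in> hom S K (D i) \<Longrightarrow>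
      \<exists>!h. h \<in> hom S K (prod_ob S J D) \<and> (\<forall>i\<in>J. prod_pr S J D i \<cdot> h = q i)"
    unfolding is_product_def is_limit_def is_cone_def by auto
qed

lemma tuple:
  assumes "finite J" "\<forall>i\<in>J. D i \<in> Obj S" "K \<in> Obj S" "\<forall>i\<in>J. q i \<in> hom S K (D i)"
  shows "tuple S J D K q \<in> hom S K (prod_ob S J D)"
    and "i \<in> J \<Longrightarrow> prod_pr S J D i \<cdot> tuple S J D K q = q i"
  using theI'[OF prod_cone(3)[OF assms]] unfolding tuple_def by blast+

lemma prod_ext:
  assumes "finite J" "\<forall>i\<in>J. D i \<in> Obj S" "g \<in> hom S K (prod_ob S J D)"
    "h \<in> hom S K (prod_ob S J D)" "\<forall>i\<in>J. prod_pr S J D i \<cdot> g = prod_pr S J D i \<cdot> h"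
  shows "g = h"
proof -
  have "\<forall>i\<in>J. prod_pr S J D i \<cdot> h \<in> hom S K (D i)"
    using Comp_in_hom[OF assms(4) prod_cone(2)[OF assms(1,2)]] by blast
  from prod_cone(3)[OF assms(1,2) hom_Obj(1)[OF assms(3)] this]
  show ?thesis by (rule ex1E) (use assms in metis)
qed

text \<open>Both sides have the components \<open>q' i\<close>. This naturality moves the arguments
  of a symbol to another stage.\<close>

lemma tuple_Comp:
  assumes "finite J" "\<forall>i\<in>J. D i \<in> Obj S" "\<forall>i\<in>J. q i \<in> hom S K (D i)"
    "h \<in> hom S K' K" "\<forall>i\<in>J. q i \<cdot> h = q' i"
  shows "tuple S J D K q \<cdot> h = tuple S J D K' q'"
proof -
  have K: "K \<in> Obj S" "K' \<in> Obj S" using hom_Obj[OF assms(4)] by auto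
  have q': "\<forall>i\<in>J. q' i \<in> hom S K' (D i)"
    using Comp_in_hom[OF assms(4)] assms(3,5) by metis
  note t = tuple[OF assms(1,2) K(1) assms(3)] and t' = tuple[OF assms(1,2) K(2) q']
  have "prod_pr S J D i \<cdot> (tuple S J D K q \<cdot> h) = prod_pr S J D i \<cdot> tuple S J D K' q'"
    if "i \<in> J" for i
    using Comp_assoc[OF assms(4) t(1) prod_cone(2)[OF assms(1,2) that]] t(2)[OF that]
      t'(2)[OF that] assms(5) that by simp
  then show ?thesis
    using prod_ext[OF assms(1,2) Comp_in_hom[OF assms(4) t(1)] t'(1)] by blast
qed

end


section \<open>Kripke--Joyal forcing\<close>

abbreviation args_val ::
  "('o, 'a, 'm) category_struct_scheme \<Rightarrow> ('s, 'f, 'r, 'o, 'a) interp \<Rightarrow> 's list \<Rightarrow> 'o \<Rightarrow> 'a list \<Rightarrow> 'a" where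
  "args_val S I ss K as \<equiv> tuple S {..<length ss} (\<lambda>i. sort_int I (ss ! i)) K (\<lambda>i. as ! i)"

primrec tm_val ::
  "('o, 'a, 'm) category_struct_scheme \<Rightarrow> ('s, 'f, 'r, 'v) language \<Rightarrow>
   ('s, 'f, 'r, 'o, 'a) interp \<Rightarrow> 'o \<Rightarrow> ('v \<Rightarrow> 'a) \<Rightarrow> ('f, 'v) tm \<Rightarrow> 'a" where
  "tm_val S L I K a (Var x) = a x"
| "tm_val S L I K a (Fn f ts) =
     fun_int I f \<cdot>\<^bsub>S\<^esub> args_val S I (fdom L f) K (map (tm_val S L I K a) ts)"

text \<open>
  An environment at stage \<open>K\<close> assigns to each variable \<open>x\<close> a generalized element, that is, an
  arrow \<open>a x\<close> from \<open>K\<close>.  No context appears here, so forcing depends only on the free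
  variables, whereas for \<open>form_int\<close> the change of context would require the Beck--Chevalley
  condition.
\<close>

primrec forces ::
  "('o, 'a, 'm) category_struct_scheme \<Rightarrow> ('s, 'f, 'r, 'v) language \<Rightarrow>
   ('s, 'f, 'r, 'o, 'a) interp \<Rightarrow> ('f, 'r, 'v) form \<Rightarrow> 'o \<Rightarrow> ('v \<Rightarrow> 'a) \<Rightarrow> bool" where
  "forces S L I Top K a \<longleftrightarrow> True"
| "forces S L I (Eq t u) K a \<longleftrightarrow> tm_val S L I K a t = tm_val S L I K a u"
| "forces S L I (Rel R ts) K a \<longleftrightarrow>
     sub_le S (args_val S I (rdom L R) K (map (tm_val S L I K a) ts)) (rel_int I R)"
| "forces S L I (Conj \<phi> \<psi>) K a \<longleftrightarrow> forces S L I \<phi> K a \<and> forces S L I \<psi> K a"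
| "forces S L I (Ex x \<phi>) K a \<longleftrightarrow>
     (\<exists>K' r b. regular_epi S r \<and> r \<in> hom S K' K \<and> b \<in> hom S K' (sort_int I (vsort L x)) \<and>
        forces S L I \<phi> K' ((\<lambda>y. a y \<cdot>\<^bsub>S\<^esub> r)(x := b)))"

lemma tm_val_cong: "(\<And>x. x \<in> tm_fv t \<Longrightarrow> a x = b x) \<Longrightarrow> tm_val S L I K a t = tm_val S L I K b t"
proof (induction t)
  case (Fn f ts)
  then have "map (tm_val S L I K a) ts = map (tm_val S L I K b) ts" by auto
  then show ?case by (simp only: tm_val.simps)
qed simp

lemma forces_cong: "(\<And>x. x \<in> fv \<phi> \<Longrightarrow> a x = b x) \<Longrightarrow> forces S L I \<phi> K a \<longleftrightarrow> forces S L I \<phi> K b"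
proof (induction \<phi> arbitrary: K a b)
  case (Eq t u)
  then have "tm_val S L I K a t = tm_val S L I K b t" "tm_val S L I K a u = tm_val S L I K b u"
    by (auto intro!: tm_val_cong)
  then show ?case by (simp only: forces.simps)
next
  case (Rel R ts)
  then have "map (tm_val S L I K a) ts = map (tm_val S L I K b) ts"
    by (auto intro!: tm_val_cong)
  then show ?case by (simp only: forces.simps)
next
  case (Conj \<phi> \<psi>)
  then show ?case by (metis UnCI forces.simps(4) fv.simps(4))
next
  case (Ex x \<phi>)
  \<comment> \<open>\<open>x\<close> takes the same value \<open>c\<close> in both environments, so
    agreement of \<open>a\<close> and \<open>b\<close> is needed only on \<open>fv \<phi>\<close>
    without \<open>x\<close>.\<close>
  have "forces S L I \<phi> K' ((\<lambda>y. a y \<cdot>\<^bsub>S\<^esub> r)(x := c)) = forces S L I \<phi> K' ((\<lambda>y. b y \<cdot>\<^bsub>S\<^esub> r)(x := c))"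
    for K' r c
    by (rule Ex.IH) (use Ex.prems in auto)
  then show ?case by simp
qed simp

section \<open>Contexts, their elements and their projections\<close>

locale regular_interpretation = regular_category S
  for S :: "('o, 'a) category_struct" (structure) +
  fixes L :: "('s, 'f, 'r, 'v) language" and I :: "('s, 'f, 'r, 'o, 'a) interp"
  assumes is_interp: "is_interpretation S L I"
begin

abbreviation "F \<equiv> ctx_ob S L I"
abbreviation "pr \<equiv> ctx_pr S L I"
abbreviation "restr \<equiv> ctx_restr S L I"

lemma sort_int_Obj: "sort_int I s \<in> Obj S"
  using is_interp by (simp add: is_interpretation_def)

lemma ctx_ob_Obj: "finite U \<Longrightarrow> F U \<in> Obj S"
  unfolding ctx_ob_def by (rule prod_cone(1)) (auto simp: sort_int_Obj)

lemma ctx_pr_hom: "finite U \<Longrightarrow> x \<in> U \<Longrightarrow> pr U x \<in> hom S (F U) (sort_int I (vsort L x))"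
  unfolding ctx_ob_def ctx_pr_def by (rule prod_cone(2)) (auto simp: sort_int_Obj)

lemma ctx_ext:
  assumes "finite U" "g \<in> hom S K (F U)" "h \<in> hom S K (F U)" "\<And>x. x \<in> U \<Longrightarrow> pr U x \<cdot> g = pr U x \<cdot> h"
  shows "g = h"
  using prod_ext[of U "\<lambda>x. sort_int I (vsort L x)" g K h] assms sort_int_Obj
  unfolding ctx_ob_def ctx_pr_def by blast

lemma ctx_elem_exists:
  assumes "finite U" "K \<in> Obj S" "\<forall>x\<in>U. a x \<in> hom S K (sort_int I (vsort L x))"
  obtains h where "h \<in> hom S K (F U)" "\<forall>x\<in>U. pr U x \<cdot> h = a x"
proof
  note t = tuple[of U "\<lambda>x. sort_int I (vsort L x)" K a]
  show "tuple S U (\<lambda>x. sort_int I (vsort L x)) K a \<in> hom S K (F U)"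
    "\<forall>x\<in>U. pr U x \<cdot> tuple S U (\<lambda>x. sort_int I (vsort L x)) K a = a x"
    using t assms sort_int_Obj unfolding ctx_ob_def ctx_pr_def by blast+
qed

lemma ctx_restr:
  assumes "finite V" "U \<subseteq> V"
  shows "restr U V \<in> hom S (F V) (F U)"
    and "x \<in> U \<Longrightarrow> pr U x \<cdot> restr U V = pr V x"
proof -
  have "\<forall>x\<in>U. pr V x \<in> hom S (F V) (sort_int I (vsort L x))"
    using ctx_pr_hom[OF assms(1)] assms(2) by blast
  with finite_subset[OF assms(2,1)] ctx_ob_Obj[OF assms(1)] sort_int_Obj
    tuple[of U "\<lambda>x. sort_int I (vsort L x)" "F V" "pr V"]
  show "restr U V \<in> hom S (F V) (F U)" "x \<in> U \<Longrightarrow> pr U x \<cdot> restr U V = pr V x"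
    unfolding ctx_restr_def ctx_ob_def[of _ _ _ U] ctx_pr_def[of _ _ _ U] by blast+
qed

lemma pr_restr_Comp:
  assumes "finite V" "U \<subseteq> V" "x \<in> U" "h \<in> hom S K (F V)"
  shows "pr U x \<cdot> (restr U V \<cdot> h) = pr V x \<cdot> h"
  using Comp_assoc[OF assms(4) ctx_restr(1)[OF assms(1,2)] ctx_pr_hom[OF finite_subset[OF assms(2,1)] assms(3)]]
    ctx_restr(2)[OF assms(1-3)] by simp

section \<open>Evaluation of terms and change of stage\<close>

lemma args_val_hom:
  assumes "K \<in> Obj S" "length as = length ss" "\<And>i. i < length ss \<Longrightarrow> as ! i \<in> hom S K (sort_int I (ss ! i))"
  shows "args_val S I ss K as \<in> hom S K (arity_ob S I ss)"
  unfolding arity_ob_def by (rule tuple(1)) (use assms sort_int_Obj in auto)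

lemma args_val_Comp:
  assumes "h \<in> hom S K' K" "length ts = length ss"
    "\<And>i. i < length ss \<Longrightarrow> f (ts ! i) \<in> hom S K (sort_int I (ss ! i))"
    "\<And>i. i < length ss \<Longrightarrow> f (ts ! i) \<cdot> h = g (ts ! i)"
  shows "args_val S I ss K (map f ts) \<cdot> h = args_val S I ss K' (map g ts)"
  by (rule tuple_Comp[OF _ _ _ assms(1)]) (use assms sort_int_Obj in auto)

lemma tm_val_hom:
  assumes "K \<in> Obj S"
  shows "tm_wf L t \<Longrightarrow> (\<And>x. x \<in> tm_fv t \<Longrightarrow> a x \<in> hom S K (sort_int I (vsort L x))) \<Longrightarrow>
    tm_val S L I K a t \<in> hom S K (sort_int I (tm_sort L t))"
proof (induction t)
  case (Fn f ts)
  have len: "length ts = length (fdom L f)" using Fn.prems(1) by (auto dest: arg_cong[of _ _ length])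
  have "tm_val S L I K a (ts ! i) \<in> hom S K (sort_int I (fdom L f ! i))" if i: "i < length (fdom L f)" for i
  proof -
    have mem: "ts ! i \<in> set ts" using i len by simp
    have "tm_sort L (ts ! i) = fdom L f ! i" using Fn.prems(1) i len nth_map[of i ts "tm_sort L"] by simp
    moreover have "tm_wf L (ts ! i)" using Fn.prems(1) mem by (simp add: list_all_iff)
    ultimately show ?thesis using Fn.IH[OF mem] Fn.prems(2) mem by fastforce
  qed
  then have "args_val S I (fdom L f) K (map (tm_val S L I K a) ts) \<in> hom S K (arity_ob S I (fdom L f))"
    by (intro args_val_hom assms) (simp_all add: len)
  moreover have "fun_int I f \<in> hom S (arity_ob S I (fdom L f)) (sort_int I (fcod L f))"
    using is_interp Fn.prems(1) by (simp add: is_interpretation_def)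
  ultimately show ?case by (simp add: Comp_in_hom)
qed simp

lemma tm_vals_hom:
  assumes "K \<in> Obj S" "map (tm_sort L) ts = ss" "list_all (tm_wf L) ts"
    "\<forall>t\<in>set ts. \<forall>x\<in>tm_fv t. a x \<in> hom S K (sort_int I (vsort L x))"
  shows "length ts = length ss"
    and "i < length ss \<Longrightarrow> tm_val S L I K a (ts ! i) \<in> hom S K (sort_int I (ss ! i))"
    and "args_val S I ss K (map (tm_val S L I K a) ts) \<in> hom S K (arity_ob S I ss)"
proof -
  show len: "length ts = length ss" using assms(2) by auto
  show *: "tm_val S L I K a (ts ! i) \<in> hom S K (sort_int I (ss ! i))" if "i < length ss" for i
  proof -
    have mem: "ts ! i \<in> set ts" using that len by simp
    have "tm_sort L (ts ! i) = map (tm_sort L) ts ! i" using that len by simp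
    also have "\<dots> = ss ! i" by (simp only: assms(2))
    finally have sort: "tm_sort L (ts ! i) = ss ! i" .
    have wf: "tm_wf L (ts ! i)" using assms(3) mem by (simp add: list_all_iff)
    have "tm_val S L I K a (ts ! i) \<in> hom S K (sort_int I (tm_sort L (ts ! i)))"
      by (rule tm_val_hom[OF assms(1) wf]) (use assms(4) mem in blast)
    then show ?thesis by (simp only: sort)
  qed
  show "args_val S I ss K (map (tm_val S L I K a) ts) \<in> hom S K (arity_ob S I ss)"
    by (intro args_val_hom assms) (simp_all add: len *)
qed

text \<open>Precomposition commutes with tupling by \<open>args_val_Comp\<close> and with the symbol
  \<open>f\<close> by associativity. Taken with the projections as \<open>a\<close>, this turns a
  term composed with an element of \<open>F U\<close> into its value at that element.\<close>

lemma tm_val_Comp: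
  assumes h: "h \<in> hom S K' K"
  shows "tm_wf L t \<Longrightarrow> (\<And>x. x \<in> tm_fv t \<Longrightarrow> a x \<in> hom S K (sort_int I (vsort L x))) \<Longrightarrow>
    tm_val S L I K a t \<cdot> h = tm_val S L I K' (\<lambda>x. a x \<cdot> h) t"
proof (induction t)
  case (Fn f ts)
  have K: "K \<in> Obj S" using hom_Obj[OF h] by simp
  have wf: "map (tm_sort L) ts = fdom L f" "list_all (tm_wf L) ts" using Fn.prems(1) by auto
  have a: "\<forall>t\<in>set ts. \<forall>x\<in>tm_fv t. a x \<in> hom S K (sort_int I (vsort L x))"
    using Fn.prems(2) by auto
  note v = tm_vals_hom[OF K wf a]
  have fh: "fun_int I f \<in> hom S (arity_ob S I (fdom L f)) (sort_int I (fcod L f))"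
    using is_interp Fn.prems(1) by (simp add: is_interpretation_def)
  have "args_val S I (fdom L f) K (map (tm_val S L I K a) ts) \<cdot> h =
      args_val S I (fdom L f) K' (map (tm_val S L I K' (\<lambda>x. a x \<cdot> h)) ts)"
  proof (rule args_val_Comp[OF h])
    fix i assume "i < length (fdom L f)"
    then have mem: "ts ! i \<in> set ts" using v(1) by simp
    moreover have "tm_wf L (ts ! i)" using wf(2) mem by (simp add: list_all_iff)
    ultimately show "tm_val S L I K a (ts ! i) \<cdot> h = tm_val S L I K' (\<lambda>x. a x \<cdot> h) (ts ! i)"
      using Fn.IH[OF mem] a by blast
  qed (use v in auto)
  then show ?case using Comp_assoc[OF h v(3) fh] by simp
qed simp

section \<open>Interpretation in a context as forcing\<close>

lemma tm_int_eq_tm_val: "tm_int S L I U t = tm_val S L I (F U) (pr U) t"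
proof (induction t)
  case (Fn f ts)
  then have "map (tm_int S L I U) ts = map (tm_val S L I (F U) (pr U)) ts" by simp
  then show ?case by (simp only: tm_int.simps tm_val.simps args_tuple_def)
qed simp

text \<open>The projections \<open>pr U\<close> form the generic environment: an element
  \<open>h\<close> of \<open>F U\<close> induces the environment
  \<open>\<lambda>x. pr U x \<cdot> h\<close>, and by the descriptions of membership each clause of
  \<open>form_int\<close> unfolds to the matching clause of \<open>forces\<close>. That the
  interpretation is a subobject is proved along with this, since the clauses for \<open>Conj\<close>
  and \<open>Ex\<close> need it of their subformulas; the context varies, since \<open>Ex\<close>
  changes it.\<close>

lemma form_int_forces:
  "form_wf L \<phi> \<Longrightarrow> finite U \<Longrightarrow> fv \<phi> \<subseteq> U \<Longrightarrow> form_int S L I \<phi> U \<in> Sub S (F U) \<and>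
    (\<forall>K. \<forall>h \<in> hom S K (F U). sub_le S h (form_int S L I \<phi> U) \<longleftrightarrow> forces S L I \<phi> K (\<lambda>x. pr U x \<cdot> h))"
proof (induction \<phi> arbitrary: U)
  case Top
  have "sub_le S h (Id S (F U))" if "h \<in> hom S K (F U)" for h K
    unfolding sub_le_iff[OF that Id_in_hom[OF ctx_ob_Obj[OF Top(2)]]] using that Id_Comp by blast
  then show ?case using Id_in_Sub[OF ctx_ob_Obj[OF Top(2)]] by simp
next
  case (Eq t u)
  have pr: "pr U x \<in> hom S (F U) (sort_int I (vsort L x))" if "x \<in> tm_fv t \<union> tm_fv u" for x
    using Eq.prems that by (intro ctx_pr_hom) auto
  have t: "tm_int S L I U t \<in> hom S (F U) (sort_int I (tm_sort L t))"
    and u: "tm_int S L I U u \<in> hom S (F U) (sort_int I (tm_sort L t))"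
    using tm_val_hom[OF ctx_ob_Obj[OF Eq.prems(2)], of t "pr U"]
      tm_val_hom[OF ctx_ob_Obj[OF Eq.prems(2)], of u "pr U"] Eq.prems(1) pr
    by (auto simp: tm_int_eq_tm_val)
  have "tm_int S L I U v \<cdot> h = tm_val S L I K (\<lambda>x. pr U x \<cdot> h) v"
    if "v \<in> {t, u}" "h \<in> hom S K (F U)" for v h K
    using tm_val_Comp[OF that(2), of v "pr U"] that(1) Eq.prems(1) pr by (auto simp: tm_int_eq_tm_val)
  then show ?case using sub_equalizer[OF t u] by auto
next
  case (Rel R ts)
  have wf: "map (tm_sort L) ts = rdom L R" "list_all (tm_wf L) ts" using Rel.prems by auto
  have R: "rel_int I R \<in> Sub S (arity_ob S I (rdom L R))"
    using is_interp Rel.prems by (simp add: is_interpretation_def)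
  have pr: "\<forall>t\<in>set ts. \<forall>x\<in>tm_fv t. pr U x \<in> hom S (F U) (sort_int I (vsort L x))"
  proof (intro ballI)
    fix t x assume "t \<in> set ts" "x \<in> tm_fv t"
    then have "x \<in> U" using Rel.prems(3) by auto
    then show "pr U x \<in> hom S (F U) (sort_int I (vsort L x))" by (rule ctx_pr_hom[OF Rel.prems(2)])
  qed
  note v = tm_vals_hom[OF ctx_ob_Obj[OF Rel.prems(2)] wf pr]
  let ?f = "args_val S I (rdom L R) (F U) (map (tm_val S L I (F U) (pr U)) ts)"
  have f: "args_tuple S L I U (rdom L R) (map (tm_int S L I U) ts) = ?f"
    unfolding args_tuple_def ext[of "tm_int S L I U", OF tm_int_eq_tm_val] ..
  have "?f \<cdot> h = args_val S I (rdom L R) K (map (tm_val S L I K (\<lambda>x. pr U x \<cdot> h)) ts)"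
    if h: "h \<in> hom S K (F U)" for h K
  proof (rule args_val_Comp[OF h v(1)])
    fix i assume "i < length (rdom L R)"
    then have mem: "ts ! i \<in> set ts" using v(1) by simp
    moreover have "tm_wf L (ts ! i)" using wf(2) mem by (simp add: list_all_iff)
    ultimately show "tm_val S L I (F U) (pr U) (ts ! i) \<cdot> h = tm_val S L I K (\<lambda>x. pr U x \<cdot> h) (ts ! i)"
      using tm_val_Comp[OF h] pr by blast
  qed (use v in auto)
  then show ?case using sub_pullback[OF v(3) R] f by simp
next
  case (Conj \<phi> \<psi>)
  then have IH: "form_int S L I \<phi> U \<in> Sub S (F U)" "form_int S L I \<psi> U \<in> Sub S (F U)"
    "\<And>K h. h \<in> hom S K (F U) \<Longrightarrow> sub_le S h (form_int S L I \<phi> U) \<longleftrightarrow> forces S L I \<phi> K (\<lambda>x. pr U x \<cdot> h)"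
    "\<And>K h. h \<in> hom S K (F U) \<Longrightarrow> sub_le S h (form_int S L I \<psi> U) \<longleftrightarrow> forces S L I \<psi> K (\<lambda>x. pr U x \<cdot> h)"
    by auto
  have M: "finite {form_int S L I \<phi> U, form_int S L I \<psi> U}"
    "{form_int S L I \<phi> U, form_int S L I \<psi> U} \<subseteq> Sub S (F U)" using IH by auto
  show ?case using sub_meet[OF M ctx_ob_Obj[OF Conj.prems(2)]] IH(3,4) by simp
next
  case (Ex x \<phi>)
  \<comment> \<open>\<open>?V\<close> is the context of the body and \<open>?W\<close> the one in
    which the image lives. If \<open>x \<in> U\<close>, then \<open>?V = U\<close>, and passing to
    \<open>?W\<close> discards the outer value of \<open>x\<close>.\<close>
  let ?V = "insert x U" and ?W = "U - {x}"
  let ?m = "form_int S L I \<phi> ?V"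
  have fin: "finite U" "finite ?V" "finite ?W" using Ex.prems by auto
  have sub: "?W \<subseteq> ?V" "?W \<subseteq> U" by auto
  have "form_wf L \<phi>" "fv \<phi> \<subseteq> ?V" using Ex.prems by auto
  with Ex.IH fin(2) have m: "?m \<in> Sub S (F ?V)"
    and IH: "\<And>K h. h \<in> hom S K (F ?V) \<Longrightarrow> sub_le S h ?m \<longleftrightarrow> forces S L I \<phi> K (\<lambda>y. pr ?V y \<cdot> h)"
    by blast+
  have mh: "?m \<in> hom S (Dom S ?m) (F ?V)" using m by (simp add: Sub_iff)
  have rU: "restr ?W U \<in> hom S (F U) (F ?W)" by (rule ctx_restr(1)) (use fin sub in auto)
  have rV: "restr ?W ?V \<in> hom S (F ?V) (F ?W)" by (rule ctx_restr(1)) (use fin sub in auto)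
  let ?f = "restr ?W ?V \<cdot> ?m"
  have f: "?f \<in> hom S (Dom S ?m) (F ?W)" using Comp_in_hom[OF mh rV] .
  note im = sub_image[OF f]
  note pb = sub_pullback[OF rU im(1)]
  have "sub_le S h (form_int S L I (Ex x \<phi>) U) \<longleftrightarrow> forces S L I (Ex x \<phi>) K (\<lambda>y. pr U y \<cdot> h)"
    if h: "h \<in> hom S K (F U)" for h K
  proof -
    have rh: "restr ?W U \<cdot> h \<in> hom S K (F ?W)" using Comp_in_hom[OF h rU] .
    have prW: "pr ?W y \<cdot> (restr ?W U \<cdot> h \<cdot> r) = pr U y \<cdot> h \<cdot> r"
      if "y \<in> ?W" "r \<in> hom S K' K" for y r K'
      using Comp_assoc[OF that(2) rh ctx_pr_hom[OF fin(3) that(1)]]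
        pr_restr_Comp[OF fin(1) sub(2) that(1) h] by simp
    \<comment> \<open>\<open>fv \<phi>\<close> is contained in \<open>?W\<close> together with
      \<open>x\<close>, so the values there determine forcing of \<open>\<phi>\<close>.\<close>
    have env: "forces S L I \<phi> K' (\<lambda>y. pr ?V y \<cdot> g) \<longleftrightarrow>
        forces S L I \<phi> K' ((\<lambda>y. pr U y \<cdot> h \<cdot> r)(x := b))"
      if "\<And>y. y \<in> ?W \<Longrightarrow> pr ?V y \<cdot> g = pr U y \<cdot> h \<cdot> r" "pr ?V x \<cdot> g = b" for K' g r b
      by (rule forces_cong) (use that Ex.prems in auto)
    have "sub_le S h (form_int S L I (Ex x \<phi>) U) \<longleftrightarrow>
      (\<exists>K' r a. regular_epi S r \<and> r \<in> hom S K' K \<and> a \<in> hom S K' (Dom S ?m) \<and>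
         restr ?W U \<cdot> h \<cdot> r = ?f \<cdot> a)"
      using pb(2)[OF h] im(2)[OF rh] by simp
    also have "\<dots> \<longleftrightarrow> forces S L I (Ex x \<phi>) K (\<lambda>y. pr U y \<cdot> h)"
    proof
      assume "\<exists>K' r a. regular_epi S r \<and> r \<in> hom S K' K \<and> a \<in> hom S K' (Dom S ?m) \<and>
         restr ?W U \<cdot> h \<cdot> r = ?f \<cdot> a"
      then obtain K' r a where r: "regular_epi S r" "r \<in> hom S K' K" and a: "a \<in> hom S K' (Dom S ?m)"
        and eq: "restr ?W U \<cdot> h \<cdot> r = ?f \<cdot> a" by blast
      \<comment> \<open>The witness for the quantifier is the \<open>x\<close>-component of this
        element of \<open>?m\<close>.\<close>
      let ?g = "?m \<cdot> a"
      have g: "?g \<in> hom S K' (F ?V)" using Comp_in_hom[OF a mh] .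
      have "restr ?W U \<cdot> h \<cdot> r = restr ?W ?V \<cdot> ?g" using eq Comp_assoc[OF a mh rV] by simp
      then have "pr ?V y \<cdot> ?g = pr U y \<cdot> h \<cdot> r" if "y \<in> ?W" for y
        using prW[OF that r(2)] pr_restr_Comp[OF fin(2) sub(1) that g] by simp
      moreover have "sub_le S ?g ?m" using sub_le_iff[OF g mh] a by blast
      ultimately have "forces S L I \<phi> K' ((\<lambda>y. pr U y \<cdot> h \<cdot> r)(x := pr ?V x \<cdot> ?g))"
        using IH[OF g] env[of ?g r] by simp
      moreover have "pr ?V x \<cdot> ?g \<in> hom S K' (sort_int I (vsort L x))"
        using Comp_in_hom[OF g ctx_pr_hom[OF fin(2)]] by blast
      ultimately show "forces S L I (Ex x \<phi>) K (\<lambda>y. pr U y \<cdot> h)" using r by auto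
    next
      assume "forces S L I (Ex x \<phi>) K (\<lambda>y. pr U y \<cdot> h)"
      then obtain K' r b where r: "regular_epi S r" "r \<in> hom S K' K"
        and b: "b \<in> hom S K' (sort_int I (vsort L x))"
        and force: "forces S L I \<phi> K' ((\<lambda>y. pr U y \<cdot> h \<cdot> r)(x := b))" by auto
      \<comment> \<open>Conversely, the updated environment is assembled into an element
        \<open>g\<close> of \<open>F ?V\<close>, and its membership in \<open>?m\<close> yields the
        lift \<open>a\<close>.\<close>
      have "\<forall>y\<in>?V. ((\<lambda>y. pr U y \<cdot> h \<cdot> r)(x := b)) y \<in> hom S K' (sort_int I (vsort L y))"
        using b Comp_in_hom[OF r(2) Comp_in_hom[OF h ctx_pr_hom[OF fin(1)]]] by auto
      then obtain g where g: "g \<in> hom S K' (F ?V)"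
        and prg: "\<forall>y\<in>?V. pr ?V y \<cdot> g = ((\<lambda>y. pr U y \<cdot> h \<cdot> r)(x := b)) y"
        using ctx_elem_exists[OF fin(2) hom_Obj(1)[OF r(2)]] by blast
      have "forces S L I \<phi> K' (\<lambda>y. pr ?V y \<cdot> g)" using env[of g r b] prg force by simp
      then obtain a where a: "a \<in> hom S K' (Dom S ?m)" "?m \<cdot> a = g"
        using IH[OF g] sub_le_iff[OF g mh] by blast
      have "restr ?W U \<cdot> h \<cdot> r = restr ?W ?V \<cdot> g"
      proof (rule ctx_ext[OF fin(3) Comp_in_hom[OF r(2) rh] Comp_in_hom[OF g rV]])
        fix y assume y: "y \<in> ?W"
        then show "pr ?W y \<cdot> (restr ?W U \<cdot> h \<cdot> r) = pr ?W y \<cdot> (restr ?W ?V \<cdot> g)"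
          using prW[OF y r(2)] pr_restr_Comp[OF fin(2) sub(1) y g] prg by auto
      qed
      then have "restr ?W U \<cdot> h \<cdot> r = ?f \<cdot> a" using a Comp_assoc[OF a(1) mh rV] by simp
      then show "\<exists>K' r a. regular_epi S r \<and> r \<in> hom S K' K \<and> a \<in> hom S K' (Dom S ?m) \<and>
         restr ?W U \<cdot> h \<cdot> r = ?f \<cdot> a" using r a by blast
    qed
    finally show ?thesis .
  qed
  then show ?case using pb(1) by simp
qed

lemma form_int_Sub: "\<phi> \<in> Forms L U \<Longrightarrow> finite U \<Longrightarrow> form_int S L I \<phi> U \<in> Sub S (F U)"
  using form_int_forces by (auto simp: Forms_def)

text \<open>Both memberships amount to forcing of \<open>\<phi>\<close> at stage \<open>K\<close>,
  in environments that agree on \<open>fv \<phi>\<close> because it lies in \<open>W\<close>. Hence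
  the interpretation in \<open>V\<close> is the pullback along \<open>restr W V\<close> of that in
  \<open>W\<close>.\<close>

lemma form_int_restr:
  assumes "\<phi> \<in> Forms L W" "W \<subseteq> V" "finite V" "h \<in> hom S K (F V)"
  shows "sub_le S h (form_int S L I \<phi> V) \<longleftrightarrow> sub_le S (restr W V \<cdot> h) (form_int S L I \<phi> W)"
proof -
  have wf: "form_wf L \<phi>" "fv \<phi> \<subseteq> W" "fv \<phi> \<subseteq> V" and W: "finite W"
    using assms finite_subset by (auto simp: Forms_def)
  have rh: "restr W V \<cdot> h \<in> hom S K (F W)"
    using Comp_in_hom[OF assms(4) ctx_restr(1)[OF assms(3,2)]] .
  have "forces S L I \<phi> K (\<lambda>x. pr V x \<cdot> h) \<longleftrightarrow> forces S L I \<phi> K (\<lambda>x. pr W x \<cdot> (restr W V \<cdot> h))"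
    by (rule forces_cong) (use pr_restr_Comp[OF assms(3,2) _ assms(4)] wf in auto)
  then show ?thesis
    using form_int_forces[OF wf(1) assms(3) wf(3)] form_int_forces[OF wf(1) W wf(2)] assms(4) rh by simp
qed

section \<open>Soundness of the inchworm fragment\<close>

lemma satisfies_of_sub_le:
  assumes C: "simplicial_complex X \<C>" and A: "subpresheaf S L I \<C> A" "no_signalling S L I \<C> A"
    and U: "U \<in> \<C>" "\<phi> \<in> Forms L U" "sub_le S (A U) (form_int S L I \<phi> U)"
  shows "satisfies S L I \<C> A \<phi>"
  unfolding satisfies_def
proof (intro ballI impI)
  fix V assume V: "V \<in> \<C>" "\<phi> \<in> Forms L V"
  \<comment> \<open>\<open>?W\<close> contains \<open>fv \<phi>\<close> and belongs to the complex,
    being a subset of \<open>U\<close>. For closed \<open>\<phi>\<close> it may be empty, and then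
    \<open>U\<close> and \<open>V\<close> are linked through the empty context.\<close>
  let ?W = "U \<inter> V"
  have W: "?W \<in> \<C>" "\<phi> \<in> Forms L ?W" "?W \<subseteq> U" "?W \<subseteq> V"
    using C U V by (auto simp: simplicial_complex_def Forms_def)
  have fin: "finite U" "finite V" "finite ?W" using C U V by (auto simp: simplicial_complex_def)
  have Ah: "A Z \<in> hom S (Dom S (A Z)) (F Z)" if "Z \<in> \<C>" for Z
    using A(1) that by (simp add: subpresheaf_def Sub_iff)
  have m: "form_int S L I \<phi> ?W \<in> Sub S (F ?W)" using form_int_Sub W fin by blast
  obtain r where r: "restricts_to S (restr ?W U) (A U) (A ?W) r"
    using A(1) U W unfolding subpresheaf_def by meson
  then have epi: "regular_epi S r" using A(2) U W unfolding no_signalling_def by blast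
  obtain s where s: "restricts_to S (restr ?W V) (A V) (A ?W) s"
    using A(1) V W unfolding subpresheaf_def by meson
  \<comment> \<open>\<open>A ?W \<cdot> r\<close> is \<open>A U\<close> followed by the projection
    to \<open>?W\<close>, so it lies in the interpretation over \<open>?W\<close>; the regular epi
    \<open>r\<close> is then removed by the fill-in.\<close>
  have "sub_le S (A ?W \<cdot> r) (form_int S L I \<phi> ?W)"
    using form_int_restr[OF W(2,3) fin(1) Ah[OF U(1)]] U(3) r by (simp add: restricts_to_def)
  then have "sub_le S (A ?W) (form_int S L I \<phi> ?W)"
    using sub_le_descend[OF epi _ Ah[OF W(1)] m] r unfolding restricts_to_def by blast
  \<comment> \<open>Going up to \<open>V\<close> is precomposition: \<open>A ?W \<cdot> s\<close> is
    \<open>A V\<close> followed by the projection.\<close>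
  then have "sub_le S (A ?W \<cdot> s) (form_int S L I \<phi> ?W)"
    using sub_le_Comp[OF Ah[OF W(1)]] m s unfolding Sub_iff restricts_to_def by blast
  then show "sub_le S (A V) (form_int S L I \<phi> V)"
    using form_int_restr[OF W(2,4) fin(2) Ah[OF V(1)]] s by (simp add: restricts_to_def)
qed

text \<open>Induction with the model \<open>A\<close> fixed. In the case \<open>cut\<close> the
  first induction hypothesis makes \<open>A\<close> satisfy \<open>\<phi>\<close>, hence a model of
  \<open>\<Delta> \<union> {\<phi>}\<close>, to which the second applies.\<close>

lemma inchworm_sound:
  assumes C: "simplicial_complex X \<C>" and X: "X \<subseteq> Vars L" and mod: "models_theory S L I ent"
  shows "inchworm L \<C> ent \<Gamma> \<phi> \<Longrightarrow> no_signalling_model S L I \<C> \<Gamma> A \<Longrightarrow> satisfies S L I \<C> A \<phi>"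
proof (induction rule: inchworm.induct)
  case (within \<Gamma> U \<phi>)
  have A: "subpresheaf S L I \<C> A" "no_signalling S L I \<C> A"
    and sat: "\<And>\<psi>. \<psi> \<in> \<Gamma> \<Longrightarrow> satisfies S L I \<C> A \<psi>"
    using within.prems by (auto simp: no_signalling_model_def)
  have U: "finite U" "U \<subseteq> Vars L" using C X within by (auto simp: simplicial_complex_def)
  \<comment> \<open>Compactness is part of \<open>models_theory\<close>: finitely many premises
    already force the conclusion, and their meet exists.\<close>
  obtain \<Delta> where \<Delta>: "finite \<Delta>" "\<Delta> \<subseteq> \<Gamma> \<inter> Forms L U"
    and le: "\<And>U. finite U \<Longrightarrow> U \<subseteq> Vars L \<Longrightarrow> (\<Union>\<psi>\<in>\<Delta>. fv \<psi>) \<union> fv \<phi> \<subseteq> U \<Longrightarrow>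
       sub_le S (sub_meet S (F U) ((\<lambda>\<psi>. form_int S L I \<psi> U) ` \<Delta>)) (form_int S L I \<phi> U)"
    using mod within(4) unfolding models_theory_def by metis
  let ?M = "(\<lambda>\<psi>. form_int S L I \<psi> U) ` \<Delta>"
  have fvs: "(\<Union>\<psi>\<in>\<Delta>. fv \<psi>) \<union> fv \<phi> \<subseteq> U" using \<Delta> within(3) by (auto simp: Forms_def)
  have M: "finite ?M" "?M \<subseteq> Sub S (F U)" using \<Delta> form_int_Sub[OF _ U(1)] by auto
  note meet = sub_meet[OF M ctx_ob_Obj[OF U(1)]]
  have Ah: "A U \<in> hom S (Dom S (A U)) (F U)"
    using A(1) within(2) by (simp add: subpresheaf_def Sub_iff)
  \<comment> \<open>Every member of \<open>\<Delta>\<close> is a premise from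
    \<open>\<Gamma>\<close> and has its free variables in \<open>U\<close>, so satisfaction by
    \<open>A\<close> applies in the context \<open>U\<close> itself.\<close>
  have "sub_le S (A U) (sub_meet S (F U) ?M)"
    using meet(2)[OF Ah] \<Delta>(2) sat within(2) by (auto simp: satisfies_def)
  then have "sub_le S (A U) (form_int S L I \<phi> U)"
    using sub_le_trans[OF Ah _ _ _ le[OF U fvs]] meet(1) form_int_Sub[OF within(3) U(1)]
    unfolding Sub_iff by blast
  then show ?case using satisfies_of_sub_le[OF C A within(2,3)] by blast
next
  case (cut \<Gamma> \<phi> \<Delta> \<psi>)
  then show ?case by (auto simp: no_signalling_model_def)
qed

end

theorem theorem19:
  fixes S :: "('o, 'a) category_struct"
    and L :: "('s, 'f, 'r, 'v) language"
    and I :: "('s, 'f, 'r, 'o, 'a) interp"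
    and X :: "'v set"
    and \<C> :: "'v set set"
    and ent :: "('f, 'r, 'v) form set \<Rightarrow> ('f, 'r, 'v) form \<Rightarrow> bool"
    and \<Gamma> :: "('f, 'r, 'v) form set"
    and \<phi> :: "('f, 'r, 'v) form"
    and A :: "'v set \<Rightarrow> 'a"
  assumes "simplicial_complex X \<C>"
    and "X \<subseteq> Vars L"
    and "regular_theory L ent"
    and "regular_category S"
    and "is_interpretation S L I"
    and "models_theory S L I ent"
    and "\<Gamma> \<subseteq> Forms_complex L \<C>"
    and "\<phi> \<in> Forms_complex L \<C>"
    and "inchworm L \<C> ent \<Gamma> \<phi>"
    and "no_signalling_model S L I \<C> \<Gamma> A"
  shows "satisfies S L I \<C> A \<phi>"
proof -
  interpret regular_category S by fact
  interpret regular_interpretation S L I by unfold_locales fact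
  show ?thesis by (rule inchworm_sound) fact+
qed

end
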